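(* Let $a:\Gamma\curvearrowright\Omega$ be a paradoxical action and let $A\in\mathcal{C}$. Then the following holds. (i) A subset $B\subseteq\Omega$ is equidecomposable to $A$ if and only if $B\in\mathcal{C}$. (ii) Suppose additionally that $A\in\mathcal{T}$ and that the family of all meager subsets of $\Omega$ is $a$-invariant. Then a subset $B\subseteq\Omega$ is $\mathcal{T}$-equidecomposable to $A$ if and only if $B\in\mathcal{C}\cap\mathcal{T}$.
   Context: Setting: $\Gamma$ is a group, $(\Omega,\tau)$ is a Polish topological space with Borel $\sigma$-algebra $\mathcal{B}$, and $a:\Gamma\curvearrowright\Omega$ is a left action by Borel automorphisms. Write $\gamma.U=\{\gamma.u: u\in U\}$ and $T.U=\bigcup_{\gamma\in T}\gamma.U$. A set $A\subseteq\Omega$ covers $B\subseteq\Omega$ if there is a finite $T\subseteq\Gamma$ with $B\subseteq T.A$. $\mathcal{C}$ is the family of all subsets of $\Omega$ that have compact closure and cover some non-empty open set. $\mathcal{T}$ is the $\sigma$-algebra of subsets of $\Omega$ with the property of Baire. For a family $\mathcal{A}\subseteq 2^\Omega$ invariant under the action, sets $A,B\subseteq\Omega$ are $\mathcal{A}$-equidecomposable if there are $m\in\mathbb{N}$, $\gamma_1,\dots,\gamma_m\in\Gamma$ and a partition $A=A_1\sqcup\dots\sqcup A_m$ with each $A_i\in\mathcal{A}$ such that $\gamma_1.A_1,\dots,\gamma_m.A_m$ partition $B$. "Equidecomposable" without qualification means $\mathcal{A}=2^\Omega$. (If the family of meager sets is $a$-invariant, then $\mathcal{T}$ is also $a$-invariant.)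 The action is called paradoxical if: (1) $\Omega$ is locally compact; (2) for every $\gamma\in\Gamma$ and every compact $C\subseteq\Omega$ the closure of $\gamma.C$ is compact; (3) any two subsets of $\Omega$ with compact closure and non-empty interior are equidecomposable. *)

theory Defs
  imports "HOL-Analysis.Analysis" "HOL-Algebra.Group_Action"
begin

text \<open>
  The Polish space is the whole type \<open>'x::polish_space\<close>. Every notion below depends only on its
  topology, not on the metric that comes with the class. The group is \<open>G\<close>, and
  \<open>a \<gamma> x\<close> stands for \<open>\<gamma>.x\<close>.
\<close>

definition borel_automorphism :: "('x::topological_space \<Rightarrow> 'x) \<Rightarrow> bool" where
  "borel_automorphism f \<longleftrightarrow>
     bij f \<and> f \<in> borel \<rightarrow>\<^sub>M borel \<and> inv_into UNIV f \<in> borel \<rightarrow>\<^sub>M borel"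

definition borel_action ::
  "('g, 'm) monoid_scheme \<Rightarrow> ('g \<Rightarrow> 'x::polish_space \<Rightarrow> 'x) \<Rightarrow> bool" where
  "borel_action G a \<longleftrightarrow>
     group_action G UNIV a \<and> (\<forall>\<gamma>\<in>carrier G. borel_automorphism (a \<gamma>))"

definition translates :: "('g \<Rightarrow> 'x \<Rightarrow> 'x) \<Rightarrow> 'g set \<Rightarrow> 'x set \<Rightarrow> 'x set" where
  "translates a T U = (\<Union>\<gamma>\<in>T. a \<gamma> ` U)"

definition covers ::
  "('g, 'm) monoid_scheme \<Rightarrow> ('g \<Rightarrow> 'x \<Rightarrow> 'x) \<Rightarrow> 'x set \<Rightarrow> 'x set \<Rightarrow> bool" where
  "covers G a A B \<longleftrightarrow> (\<exists>T. finite T \<and> T \<subseteq> carrier G \<and> B \<subseteq> translates a T A)"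

definition covering_family ::
  "('g, 'm) monoid_scheme \<Rightarrow> ('g \<Rightarrow> 'x::topological_space \<Rightarrow> 'x) \<Rightarrow> 'x set set" where
  "covering_family G a =
     {A. compact (closure A) \<and> (\<exists>U. open U \<and> U \<noteq> {} \<and> covers G a A U)}"

definition nowhere_dense :: "'x::topological_space set \<Rightarrow> bool" where
  "nowhere_dense S \<longleftrightarrow> interior (closure S) = {}"

definition meager :: "'x::topological_space set \<Rightarrow> bool" where
  "meager S \<longleftrightarrow> (\<exists>N :: nat \<Rightarrow> 'x set. (\<forall>n. nowhere_dense (N n)) \<and> S = (\<Union>n. N n))"

definition baire_property_sets :: "'x::topological_space set set" where
  "baire_property_sets = {A. \<exists>U. open U \<and> meager ((A - U) \<union> (U - A))}"

definition invariant_family ::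
  "('g, 'm) monoid_scheme \<Rightarrow> ('g \<Rightarrow> 'x \<Rightarrow> 'x) \<Rightarrow> 'x set set \<Rightarrow> bool" where
  "invariant_family G a \<F> \<longleftrightarrow> (\<forall>\<gamma>\<in>carrier G. \<forall>S\<in>\<F>. a \<gamma> ` S \<in> \<F>)"

text \<open>
  The pieces are indexed by \<open>{..<m}\<close> instead of \<open>{1..m}\<close>, and some of them may be empty.
  The notion is intended for invariant families \<open>\<F>\<close>, for which it is symmetric in the two sets.
\<close>

definition equidecomposable ::
  "('g, 'm) monoid_scheme \<Rightarrow> ('g \<Rightarrow> 'x \<Rightarrow> 'x) \<Rightarrow> 'x set set \<Rightarrow> 'x set \<Rightarrow> 'x set \<Rightarrow> bool" where
  "equidecomposable G a \<F> A B \<longleftrightarrow>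
     (\<exists>(m::nat) (\<gamma> :: nat \<Rightarrow> 'g) (P :: nat \<Rightarrow> 'x set).
        (\<forall>i<m. \<gamma> i \<in> carrier G \<and> P i \<in> \<F>) \<and>
        disjoint_family_on P {..<m} \<and> (\<Union>i<m. P i) = A \<and>
        disjoint_family_on (\<lambda>i. a (\<gamma> i) ` P i) {..<m} \<and> (\<Union>i<m. a (\<gamma> i) ` P i) = B)"

definition paradoxical_action ::
  "('g, 'm) monoid_scheme \<Rightarrow> ('g \<Rightarrow> 'x::polish_space \<Rightarrow> 'x) \<Rightarrow> bool" where
  "paradoxical_action G a \<longleftrightarrow>
     borel_action G a \<and>
     locally compact (UNIV :: 'x set) \<and>
     (\<forall>\<gamma>\<in>carrier G. \<forall>C. compact C \<longrightarrow> compact (closure (a \<gamma> ` C))) \<and>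
     (\<forall>A B. compact (closure A) \<and> interior A \<noteq> {} \<and> compact (closure B) \<and> interior B \<noteq> {} \<longrightarrow>
        equidecomposable G a UNIV A B)"

end

theory Submission
  imports Defs
begin

text \<open>
  A set equidecomposable to a member of the covering family lies in the covering family: finitely
  many translates of it cover the member, and it is contained in finitely many translates of
  a compact set, whose closures are compact. The substance is the converse, that any two members
  \<open>A\<close> and \<open>B\<close> of the covering family are equidecomposable.

  Join \<open>x \<in> A\<close> to \<open>y \<in> B\<close> whenever \<open>y = w.x\<close> for some \<open>w\<close> in a finite set \<open>W\<close> of group
  elements. If \<open>W\<close> is suitable, this graph expands: every finite \<open>F \<subseteq> A\<close> has at least \<open>2 |F|\<close>
  neighbours in \<open>B\<close> (\<open>covering_family_expansion\<close>). Indeed \<open>B\<close> covers an open set \<open>V\<close> with compact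
  closure by \<open>n\<close> translates, and unless the space is a single point, which is a trivial case, it has
  no isolated points. So \<open>V\<close> contains \<open>2 n\<close> disjoint nonempty open sets, each of which is
  equidecomposable to \<open>A \<union> V\<close> because the action is paradoxical. Hence \<open>2 n\<close> disjoint piecewise
  copies of \<open>A\<close> fit into \<open>V\<close>, while going from \<open>V\<close> to \<open>B\<close> identifies at most \<open>n\<close> points.

  For part (i), the marriage theorem for infinite families of finite sets (\<open>infinite_marriage\<close>)
  turns expansion into an injection of \<open>A\<close> into \<open>B\<close> which moves every point by an element of \<open>W\<close>. By
  symmetry there is one from \<open>B\<close> into \<open>A\<close>, and the Schroeder-Bernstein argument combines the two into
  a bijection that is again piecewise a translation
  (\<open>symmetric_maps.piecewise_Schroeder_Bernstein\<close>).

  For part (ii), the injections must have pieces with the property of Baire. The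
  Schroeder-Bernstein argument takes place inside any \<open>\<sigma>\<close>-algebra that the action preserves, so only
  a matching with the property of Baire is wanted (\<open>generic_maps.baire_matching\<close>). The method is
  that of Marks and Unger, for matchings that cover one side only. Choose Borel sets \<open>S n\<close> whose
  points are very far apart in the graph, the further the larger \<open>n\<close> is, with comeager union. At
  stage \<open>n\<close>, match every point of \<open>S n\<close> that is still unmatched, in such a way that the
  removal of this one edge preserves Hall's condition; which neighbours are admissible is
  a Baire measurable question. Hall's condition survives the simultaneous removal of all these
  edges: a finite connected set with at least two lost neighbours is so large that expansion
  outweighs the total loss, since the points lost at every stage are sparse
  (\<open>generic_maps.matching_step\<close>). What remains unmatched is meager. On its saturation, still meager,
  the matching is replaced by an arbitrary one from part (i), because every subset of a meager set
  has the property of Baire.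
\<close>

section \<open>Marriages in infinite families of finite sets\<close>

text \<open>
  Rado's argument. By finiteness of the sets \<open>N x\<close>, Zorn's lemma yields a maximal set \<open>C\<close> of candidates
  that can be deleted while Hall's condition persists. Then at most one candidate is left for every
  \<open>x\<close>: if two were left, deleting either of them would violate Hall's condition on some finite set,
  and submodularity of the cardinality of a union of neighbourhoods contradicts this on the union and
  the intersection of the two finite sets.
\<close>

theorem infinite_marriage:
  fixes N :: "'a \<Rightarrow> 'b set"
  assumes fin: "\<And>x. x \<in> A \<Longrightarrow> finite (N x)"
    and hall: "\<And>F. finite F \<Longrightarrow> F \<subseteq> A \<Longrightarrow> card F \<le> card (\<Union>x\<in>F. N x)"
  shows "\<exists>f. inj_on f A \<and> (\<forall>x\<in>A. f x \<in> N x)"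
proof -
  define \<A> where "\<A> = {C. \<forall>F. finite F \<and> F \<subseteq> A \<longrightarrow> card F \<le> card (\<Union>x\<in>F. N x - C `` {x})}"
  have "\<exists>C\<in>\<A>. \<forall>X\<in>\<A>. C \<subseteq> X \<longrightarrow> X = C"
  proof (rule subset_Zorn_nonempty)
    have "{} \<in> \<A>" using hall by (simp add: \<A>_def)
    then show "\<A> \<noteq> {}" by blast
    fix \<C> assume ne: "\<C> \<noteq> {}" and ch: "subset.chain \<A> \<C>"
    have "card F \<le> card (\<Union>x\<in>F. N x - \<Union>\<C> `` {x})" if F: "finite F" "F \<subseteq> A" for F
    proof -
      have finS: "finite (Sigma F N)" using F fin by blast
      \<comment> \<open>Only finitely many deletions matter for \<open>F\<close>, so one member of the chain contains them all.\<close>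
      have "finite (Sigma F N \<inter> \<Union>\<C>)" using finS by blast
      then obtain C where C: "C \<in> \<C>" "Sigma F N \<inter> \<Union>\<C> \<subseteq> C"
        by (rule finite_subset_Union_chain[OF _ _ ne ch]) auto
      have "C \<in> \<A>" using C ch by (auto simp: subset_chain_def)
      then have "card F \<le> card (\<Union>x\<in>F. N x - C `` {x})" using F by (simp add: \<A>_def)
      also have "(\<Union>x\<in>F. N x - C `` {x}) = (\<Union>x\<in>F. N x - \<Union>\<C> `` {x})"
        using C by blast
      finally show ?thesis .
    qed
    then show "\<Union>\<C> \<in> \<A>" by (simp add: \<A>_def)
  qed
  then obtain C where C: "C \<in> \<A>" and max: "\<And>X. X \<in> \<A> \<Longrightarrow> C \<subseteq> X \<Longrightarrow> X = C" by blast
  define M where "M x = N x - C `` {x}" for x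
  have finM: "finite (M x)" if "x \<in> A" for x using fin[OF that] by (simp add: M_def)
  have hallM: "card F \<le> card (\<Union>x\<in>F. M x)" if "finite F" "F \<subseteq> A" for F
    using C that by (simp add: \<A>_def M_def)
  \<comment> \<open>By maximality, deleting one more candidate of \<open>x\<close> violates Hall's condition on some \<open>insert x K\<close>.\<close>
  have tight: "\<exists>K. finite K \<and> K \<subseteq> A \<and> x \<notin> K \<and> card ((\<Union>z\<in>K. M z) \<union> (M x - {y})) \<le> card K"
    if x: "x \<in> A" and y: "y \<in> M x" for x y
  proof -
    have "insert (x, y) C \<notin> \<A>"
      using max[of "insert (x, y) C"] y by (auto simp: M_def)
    then obtain F where F: "finite F" "F \<subseteq> A"
      and small: "card (\<Union>z\<in>F. N z - insert (x, y) C `` {z}) < card F"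
      by (auto simp: \<A>_def not_le)
    have eq: "N z - insert (x, y) C `` {z} = (if z = x then M x - {y} else M z)" for z
      by (auto simp: M_def)
    have xF: "x \<in> F"
    proof (rule ccontr)
      assume "x \<notin> F"
      then have "(\<Union>z\<in>F. N z - insert (x, y) C `` {z}) = (\<Union>z\<in>F. M z)"
        unfolding eq by (intro SUP_cong) auto
      then show False using small hallM[OF F] by simp
    qed
    have "(\<Union>z\<in>F. N z - insert (x, y) C `` {z}) = (\<Union>z\<in>F - {x}. M z) \<union> (M x - {y})"
      unfolding eq using xF by (auto split: if_splits)
    then have "card ((\<Union>z\<in>F - {x}. M z) \<union> (M x - {y})) \<le> card (F - {x})"
      using small F xF by simp
    then show ?thesis using F by (intro exI[of _ "F - {x}"]) auto
  qed
  have uniq: "y = y'" if x: "x \<in> A" and y: "y \<in> M x" and y': "y' \<in> M x" for x y y'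
  proof (rule ccontr)
    assume neq: "y \<noteq> y'"
    obtain K where K: "finite K" "K \<subseteq> A" "x \<notin> K"
      and cK: "card ((\<Union>z\<in>K. M z) \<union> (M x - {y})) \<le> card K"
      using tight[OF x y] by blast
    obtain L where L: "finite L" "L \<subseteq> A" "x \<notin> L"
      and cL: "card ((\<Union>z\<in>L. M z) \<union> (M x - {y'})) \<le> card L"
      using tight[OF x y'] by blast
    let ?P = "(\<Union>z\<in>K. M z) \<union> (M x - {y})" and ?Q = "(\<Union>z\<in>L. M z) \<union> (M x - {y'})"
    have finP: "finite ?P" using K finM x by blast
    have finQ: "finite ?Q" using L finM x by blast
    have "card (insert x (K \<union> L)) \<le> card (\<Union>z\<in>insert x (K \<union> L). M z)"
      using K L x by (intro hallM) auto
    moreover have "(\<Union>z\<in>insert x (K \<union> L). M z) = ?P \<union> ?Q" using neq by blast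
    ultimately have u: "Suc (card (K \<union> L)) \<le> card (?P \<union> ?Q)" using K L by simp
    have "card (K \<inter> L) \<le> card (\<Union>z\<in>K \<inter> L. M z)" using K by (intro hallM) auto
    also have "\<dots> \<le> card (?P \<inter> ?Q)" using finP by (intro card_mono) auto
    finally have i: "card (K \<inter> L) \<le> card (?P \<inter> ?Q)" .
    have "card ?P + card ?Q = card (?P \<union> ?Q) + card (?P \<inter> ?Q)"
      by (rule card_Un_Int[OF finP finQ])
    moreover have "card K + card L = card (K \<union> L) + card (K \<inter> L)"
      using K L by (intro card_Un_Int)
    ultimately show False using u i cK cL by linarith
  qed
  have ne: "M x \<noteq> {}" if "x \<in> A" for x using hallM[of "{x}"] that by auto
  define f where "f x = (SOME y. y \<in> M x)" for x
  have fM: "f x \<in> M x" if "x \<in> A" for x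
    unfolding f_def using ne[OF that] by (simp add: some_in_eq)
  have "inj_on f A"
  proof (rule inj_onI, rule ccontr)
    fix x x' assume x: "x \<in> A" "x' \<in> A" "f x = f x'" "x \<noteq> x'"
    have "M x \<union> M x' \<subseteq> {f x}" using uniq fM x by auto
    then have "card (M x \<union> M x') \<le> 1" using card_mono[of "{f x}"] by fastforce
    moreover have "card {x, x'} \<le> card (\<Union>z\<in>{x, x'}. M z)" using x by (intro hallM) auto
    ultimately show False using x by simp
  qed
  then show ?thesis using fM by (auto simp: M_def)
qed

section \<open>Graphs spanned by finitely many maps\<close>

text \<open>
  The neighbourhood of \<open>F\<close> in the graph whose edges are the pairs \<open>(x, e x)\<close> with \<open>e \<in> E\<close>.
\<close>

definition moves :: "('x \<Rightarrow> 'x) set \<Rightarrow> 'x set \<Rightarrow> 'x set" where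
  "moves E F = (\<Union>e\<in>E. e ` F)"

definition hall :: "('x \<Rightarrow> 'x) set \<Rightarrow> 'x set \<Rightarrow> 'x set \<Rightarrow> bool" where
  "hall E A B \<longleftrightarrow> (\<forall>F. finite F \<and> F \<subseteq> A \<longrightarrow> card F \<le> card (moves E F \<inter> B))"

lemma moves_Un: "moves E (F \<union> F') = moves E F \<union> moves E F'"
  by (auto simp: moves_def)

lemma finite_moves: "finite E \<Longrightarrow> finite F \<Longrightarrow> finite (moves E F)"
  by (auto simp: moves_def)

lemma hallD: "hall E A B \<Longrightarrow> finite F \<Longrightarrow> F \<subseteq> A \<Longrightarrow> card F \<le> card (moves E F \<inter> B)"
  by (simp add: hall_def)

lemma hall_if_expanding:
  assumes "\<And>F. finite F \<Longrightarrow> F \<subseteq> A \<Longrightarrow> 2 * card F \<le> card (moves E F \<inter> B)"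
  shows "hall E A B"
  unfolding hall_def
proof (intro allI impI, elim conjE)
  fix F assume "finite F" "F \<subseteq> A"
  then show "card F \<le> card (moves E F \<inter> B)" using assms[of F] by linarith
qed

lemma hall_iff_injection:
  assumes "finite E"
  shows "hall E A B \<longleftrightarrow> (\<exists>f. inj_on f A \<and> (\<forall>x\<in>A. f x \<in> B \<and> (\<exists>e\<in>E. f x = e x)))"
proof
  assume h: "hall E A B"
  have eq: "(\<Union>x\<in>F. {y \<in> B. \<exists>e\<in>E. y = e x}) = moves E F \<inter> B" for F
    by (auto simp: moves_def)
  have "\<exists>f. inj_on f A \<and> (\<forall>x\<in>A. f x \<in> {y \<in> B. \<exists>e\<in>E. y = e x})"
  proof (rule infinite_marriage)
    show "finite {y \<in> B. \<exists>e\<in>E. y = e x}" for x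
      by (rule finite_subset[of _ "(\<lambda>e. e x) ` E"]) (use assms in auto)
    show "card F \<le> card (\<Union>x\<in>F. {y \<in> B. \<exists>e\<in>E. y = e x})" if "finite F" "F \<subseteq> A" for F
      unfolding eq using h that by (rule hallD)
  qed
  then show "\<exists>f. inj_on f A \<and> (\<forall>x\<in>A. f x \<in> B \<and> (\<exists>e\<in>E. f x = e x))" by blast
next
  assume "\<exists>f. inj_on f A \<and> (\<forall>x\<in>A. f x \<in> B \<and> (\<exists>e\<in>E. f x = e x))"
  then obtain f where f: "inj_on f A" "\<And>x. x \<in> A \<Longrightarrow> f x \<in> B \<and> (\<exists>e\<in>E. f x = e x)" by blast
  show "hall E A B" unfolding hall_def
  proof (intro allI impI)
    fix F assume F: "finite F \<and> F \<subseteq> A"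
    have "card F = card (f ` F)" using F f(1) by (metis card_image inj_on_subset)
    also have "\<dots> \<le> card (moves E F \<inter> B)"
    proof (intro card_mono finite_Int disjI1 finite_moves assms)
      show "f ` F \<subseteq> moves E F \<inter> B" using F f(2) by (fastforce simp: moves_def)
    qed (use F in blast)
    finally show "card F \<le> card (moves E F \<inter> B)" .
  qed
qed

text \<open>
  The edge can be taken from a matching of \<open>A\<close> into \<open>B\<close>, the rest of which still matches the other
  points.
\<close>

lemma hall_remove_edge:
  assumes "finite E" "hall E A B" "x \<in> A"
  shows "\<exists>e\<in>E. e x \<in> B \<and> hall E (A - {x}) (B - {e x})"
proof -
  obtain f where f: "inj_on f A" "\<And>x. x \<in> A \<Longrightarrow> f x \<in> B \<and> (\<exists>e\<in>E. f x = e x)"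
    using assms(2) unfolding hall_iff_injection[OF assms(1)] by blast
  obtain e where e: "e \<in> E" "f x = e x" using f(2) assms(3) by blast
  have "inj_on f (A - {x})" using f(1) by (rule inj_on_subset) auto
  moreover have "\<forall>z\<in>A - {x}. f z \<in> B - {e x} \<and> (\<exists>e\<in>E. f z = e z)"
  proof
    fix z assume z: "z \<in> A - {x}"
    then have "f z \<noteq> f x" using f(1) assms(3) by (auto dest: inj_onD)
    then show "f z \<in> B - {e x} \<and> (\<exists>e\<in>E. f z = e z)" using f(2)[of z] e(2) z by simp
  qed
  ultimately have "hall E (A - {x}) (B - {e x})"
    unfolding hall_iff_injection[OF assms(1)] by blast
  then show ?thesis using e f(2)[OF assms(3)] by metis
qed

text \<open>
  The measure \<open>M\<close> serves only as a \<open>\<sigma>\<close>-algebra of admissible pieces. The pieces \<open>{x \<in> A. f x = e x}\<close>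
  cover \<open>A\<close> but may overlap.
\<close>

definition piecewise_injection ::
  "('x \<Rightarrow> 'x) set \<Rightarrow> 'x measure \<Rightarrow> 'x set \<Rightarrow> 'x set \<Rightarrow> ('x \<Rightarrow> 'x) \<Rightarrow> bool" where
  "piecewise_injection E M A B f \<longleftrightarrow> inj_on f A \<and> (\<forall>x\<in>A. f x \<in> B \<and> (\<exists>e\<in>E. f x = e x)) \<and>
     (\<forall>e\<in>E. {x \<in> A. f x = e x} \<in> sets M)"

section \<open>Counting spread-out points near a connected set\<close>

text \<open>
  Connectedness of \<open>F\<close>, where two points count as adjacent if they have a common neighbour. Hall's
  condition needs to be tested on such sets only (\<open>hall_if_unsplit\<close>), as the parts of a split set
  have disjoint neighbourhoods.
\<close>

definition unsplit :: "('x \<Rightarrow> 'x) set \<Rightarrow> 'x set \<Rightarrow> bool" where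
  "unsplit E F \<longleftrightarrow>
     (\<forall>F1. F1 \<subseteq> F \<and> F1 \<noteq> {} \<and> F1 \<noteq> F \<longrightarrow> moves E F1 \<inter> moves E (F - F1) \<noteq> {})"

lemma hall_if_unsplit:
  assumes "finite E"
    and conn: "\<And>F. finite F \<Longrightarrow> F \<subseteq> A \<Longrightarrow> unsplit E F \<Longrightarrow> card F \<le> card (moves E F \<inter> B)"
  shows "hall E A B"
  unfolding hall_def
proof (intro allI impI, elim conjE)
  fix F :: "'a set" assume "finite F" "F \<subseteq> A"
  then show "card F \<le> card (moves E F \<inter> B)"
  proof (induction F rule: finite_psubset_induct)
    case (psubset F)
    show ?case
    proof (cases "unsplit E F")
      case True
      then show ?thesis using conn psubset by blast
    next
      case False
      then obtain F1 where F1: "F1 \<subseteq> F" "F1 \<noteq> {}" "F1 \<noteq> F"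
        and dis: "moves E F1 \<inter> moves E (F - F1) = {}" by (auto simp: unsplit_def)
      have fin: "finite F1" "finite (F - F1)" using psubset(1) F1 by (auto intro: finite_subset)
      have "card F = card F1 + card (F - F1)"
        using F1 psubset(1) by (metis card_Diff_subset card_mono fin(1) le_add_diff_inverse)
      also have "\<dots> \<le> card (moves E F1 \<inter> B) + card (moves E (F - F1) \<inter> B)"
        using F1 psubset.prems by (intro add_mono psubset.IH) auto
      also have "\<dots> = card ((moves E F1 \<inter> B) \<union> (moves E (F - F1) \<inter> B))"
        using dis fin assms(1) by (intro card_Un_disjoint[symmetric]) (auto intro: finite_moves)
      also have "(moves E F1 \<inter> B) \<union> (moves E (F - F1) \<inter> B) = moves E F \<inter> B"
        using F1 by (metis Int_Un_distrib2 Un_Diff_cancel moves_Un sup.absorb_iff2)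
      finally show ?thesis .
    qed
  qed
qed

text \<open>
  Compositions of \<open>n\<close> maps from \<open>E\<close>. If the identity belongs to \<open>E\<close>, these describe the paths of
  length at most \<open>n\<close>.
\<close>

fun words :: "('x \<Rightarrow> 'x) set \<Rightarrow> nat \<Rightarrow> ('x \<Rightarrow> 'x) set" where
  "words E 0 = {id}"
| "words E (Suc n) = (\<lambda>(e, u). e \<circ> u) ` (E \<times> words E n)"

declare words.simps(2) [simp del]

lemma words_SucI: "e \<in> E \<Longrightarrow> u \<in> words E n \<Longrightarrow> e \<circ> u \<in> words E (Suc n)"
  by (force simp: words.simps(2))

lemma words_SucE:
  assumes "v \<in> words E (Suc n)"
  obtains e u where "v = e \<circ> u" "e \<in> E" "u \<in> words E n"
  using assms by (auto simp: words.simps(2))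

lemma words_comp: "u \<in> words E m \<Longrightarrow> v \<in> words E n \<Longrightarrow> v \<circ> u \<in> words E (n + m)"
proof (induction n arbitrary: v)
  case (Suc n)
  from Suc.prems(2) obtain e w where v: "v = e \<circ> w" "e \<in> E" "w \<in> words E n" by (rule words_SucE)
  have "e \<circ> (w \<circ> u) \<in> words E (Suc (n + m))"
    using v Suc.IH[of w] Suc.prems(1) by (intro words_SucI)
  then show ?case by (simp only: v(1) comp_assoc add_Suc)
qed auto

lemma finite_words: "finite E \<Longrightarrow> finite (words E n)"
  by (induction n) (auto simp: words.simps(2))

lemma words_1: "words E 1 = E"
  by (auto simp: words.simps(2) image_iff)

definition near :: "('x \<Rightarrow> 'x) set \<Rightarrow> nat \<Rightarrow> 'x \<Rightarrow> 'x \<Rightarrow> bool" where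
  "near E n x y \<longleftrightarrow> (\<exists>u\<in>words E n. u x = y)"

lemma near_trans: "near E m x y \<Longrightarrow> near E n y z \<Longrightarrow> near E (m + n) x z"
proof -
  assume "near E m x y" "near E n y z"
  then obtain u v where "u \<in> words E m" "v \<in> words E n" "v (u x) = z"
    by (auto simp: near_def)
  then show "near E (m + n) x z"
    using words_comp[of u E m v n] by (auto simp: near_def add.commute intro: bexI[of _ "v \<circ> u"])
qed

lemma near_move: "e \<in> E \<Longrightarrow> near E 1 x (e x)"
  unfolding near_def words_1 by blast

definition spread_out :: "('x \<Rightarrow> 'x) set \<Rightarrow> nat \<Rightarrow> 'x set \<Rightarrow> bool" where
  "spread_out E n S \<longleftrightarrow> (\<forall>x\<in>S. \<forall>y\<in>S. near E n x y \<longrightarrow> x = y)"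

locale symmetric_maps =
  fixes E :: "('x \<Rightarrow> 'x) set"
  assumes finite_E: "finite E"
    and id_E: "id \<in> E"
    and inverse_E: "\<And>e. e \<in> E \<Longrightarrow> \<exists>e'\<in>E. e' \<circ> e = id \<and> e \<circ> e' = id"
begin

lemma words_inverse: "u \<in> words E n \<Longrightarrow> \<exists>v\<in>words E n. v \<circ> u = id \<and> u \<circ> v = id"
proof (induction n arbitrary: u)
  case (Suc n)
  then obtain e w where u: "u = e \<circ> w" "e \<in> E" "w \<in> words E n" by (auto elim: words_SucE)
  obtain e' where e': "e' \<in> E" "e' \<circ> e = id" "e \<circ> e' = id" using inverse_E u by blast
  obtain v where v: "v \<in> words E n" "v \<circ> w = id" "w \<circ> v = id" using Suc.IH[OF u(3)] by blast
  have "e' \<in> words E 1" using e'(1) unfolding words_1 .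
  from words_comp[OF this v(1)] have "v \<circ> e' \<in> words E (Suc n)" by simp
  moreover have "(v \<circ> e') \<circ> u = id"
    unfolding u(1) using v(2) e'(2) by (simp add: fun_eq_iff)
  moreover have "u \<circ> (v \<circ> e') = id"
    unfolding u(1) using v(3) e'(3) by (simp add: fun_eq_iff)
  ultimately show ?case by blast
qed auto

lemma near_sym: "near E n x y \<Longrightarrow> near E n y x"
proof -
  assume "near E n x y"
  then obtain u where u: "u \<in> words E n" "u x = y" by (auto simp: near_def)
  then obtain v where v: "v \<in> words E n" "v \<circ> u = id" using words_inverse by blast
  have "v y = x" using fun_cong[OF v(2), of x] u(2) by simp
  then show "near E n y x" using v(1) unfolding near_def by blast
qed

lemma near_Suc: "near E n x y \<Longrightarrow> near E (Suc n) x y"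
proof -
  assume "near E n x y"
  moreover have "near E 1 y y" using near_move[OF id_E, of y] unfolding id_apply .
  ultimately have "near E (n + 1) x y" by (rule near_trans)
  then show "near E (Suc n) x y" unfolding Suc_eq_plus1 .
qed

lemma near_mono:
  assumes "m \<le> n" "near E m x y"
  shows "near E n x y"
proof -
  have "near E (m + k) x y" for k
  proof (induction k)
    case 0
    show ?case using assms(2) by simp
  next
    case (Suc k)
    show ?case unfolding add_Suc_right by (rule near_Suc[OF Suc.IH])
  qed
  from this[of "n - m"] show ?thesis using assms(1) by simp
qed

lemma near_refl: "near E n x x"
proof (rule near_mono[of 0 n])
  show "near E 0 x x" by (simp add: near_def)
qed simp

text \<open>
  Each enlargement of the ball by two steps adds a point of \<open>F\<close>, until the ball exhausts \<open>F\<close>.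
\<close>

lemma card_near_unsplit:
  assumes F: "finite F" "unsplit E F" "x \<in> F"
  shows "min (card F) (Suc r) \<le> card {z \<in> F. near E (2 * r) x z}"
proof (induction r)
  case 0
  have "{x} \<subseteq> {z \<in> F. near E (2 * 0) x z}" using F(3) near_refl[of "2 * 0" x] by simp
  then have "card {x} \<le> card {z \<in> F. near E (2 * 0) x z}" using F(1) by (intro card_mono) auto
  then show ?case by simp
next
  case (Suc r)
  let ?R = "\<lambda>r. {z \<in> F. near E (2 * r) x z}"
  have sub: "?R r \<subseteq> ?R (Suc r)" using near_mono[of "2 * r" "2 * Suc r" x] by auto
  show ?case
  proof (cases "?R r = F")
    case True
    then have "?R (Suc r) = F" using sub by auto
    then show ?thesis by simp
  next
    case False
    have "x \<in> ?R r" using F(3) near_refl[of "2 * r" x] by simp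
    then have "?R r \<subseteq> F \<and> ?R r \<noteq> {} \<and> ?R r \<noteq> F" using False by auto
    then have "moves E (?R r) \<inter> moves E (F - ?R r) \<noteq> {}"
      using F(2)[unfolded unsplit_def, rule_format, of "?R r"] by simp
    then obtain w where w: "w \<in> moves E (?R r)" "w \<in> moves E (F - ?R r)" by blast
    obtain z e where z: "z \<in> ?R r" "e \<in> E" "w = e z"
      using w(1) unfolding moves_def by blast
    obtain z' e' where z': "z' \<in> F - ?R r" "e' \<in> E" "w = e' z'"
      using w(2) unfolding moves_def by blast
    have xz: "near E (2 * r) x z" using z(1) by blast
    have zw: "near E 1 z w" unfolding z(3) by (rule near_move[OF z(2)])
    have zw': "near E 1 z' w" unfolding z'(3) by (rule near_move[OF z'(2)])
    have "near E (2 * r + 1 + 1) x z'"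
      by (rule near_trans[OF near_trans[OF xz zw] near_sym[OF zw']])
    then have "near E (2 * Suc r) x z'" by simp
    then have "?R r \<subset> ?R (Suc r)" using sub z'(1) by blast
    then have "card (?R r) < card (?R (Suc r))" using F(1) by (intro psubset_card_mono) auto
    then show ?thesis using Suc.IH by linarith
  qed
qed

text \<open>
  Every point of \<open>moves E F \<inter> Y\<close> is a neighbour of some point of \<open>F\<close>. The balls of radius \<open>2 r\<close> in \<open>F\<close>
  around these points are disjoint because \<open>Y\<close> is spread out, and each has more than \<open>r\<close> elements
  unless it is all of \<open>F\<close>, which is possible for a single ball only.
\<close>

lemma card_moves_spread_out:
  assumes F: "finite F" "unsplit E F" and Y: "spread_out E (4 * r + 2) Y"
  shows "card (moves E F \<inter> Y) \<le> 1 \<or> card (moves E F \<inter> Y) * Suc r \<le> card F"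
proof (cases "card (moves E F \<inter> Y) \<le> 1")
  case False
  let ?Y = "moves E F \<inter> Y"
  have finY: "finite ?Y" using F finite_E finite_moves by blast
  obtain p where p: "\<And>y. y \<in> ?Y \<Longrightarrow> p y \<in> F \<and> (\<exists>e\<in>E. y = e (p y))"
  proof -
    have "\<forall>y\<in>?Y. \<exists>x. x \<in> F \<and> (\<exists>e\<in>E. y = e x)" by (auto simp: moves_def)
    then show thesis using that by metis
  qed
  define R where "R y = {z \<in> F. near E (2 * r) (p y) z}" for y
  have dis: "y = y'" if y: "y \<in> ?Y" "y' \<in> ?Y" and z: "z \<in> R y" "z \<in> R y'" for y y' z
  proof -
    have 1: "near E 1 y (p y)" using p[OF y(1)] near_move near_sym by metis
    have 2: "near E 1 (p y') y'" using p[OF y(2)] near_move by metis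
    have 3: "near E (2 * r) (p y) z" "near E (2 * r) (p y') z" using z by (auto simp: R_def)
    have "near E (1 + 2 * r + 2 * r + 1) y y'"
      by (rule near_trans[OF near_trans[OF near_trans[OF 1 3(1)] near_sym[OF 3(2)]] 2])
    then have "near E (4 * r + 2) y y'" by (simp add: algebra_simps)
    then show ?thesis using Y y by (auto simp: spread_out_def)
  qed
  have "card ?Y * min (card F) (Suc r) = (\<Sum>y\<in>?Y. min (card F) (Suc r))" by simp
  also have "\<dots> \<le> (\<Sum>y\<in>?Y. card (R y))"
    unfolding R_def using p F by (intro sum_mono card_near_unsplit) auto
  also have "\<dots> = card (\<Union>y\<in>?Y. R y)"
    using finY F dis by (intro card_UN_disjoint[symmetric]) (auto simp: R_def)
  also have "\<dots> \<le> card F" using F by (intro card_mono) (auto simp: R_def)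
  finally have *: "card ?Y * min (card F) (Suc r) \<le> card F" .
  have "card F > 0"
  proof -
    have "?Y \<noteq> {}" using False by (metis card.empty zero_le)
    then show ?thesis using F by (auto simp: moves_def card_gt_0_iff)
  qed
  moreover have "2 * card F \<le> card ?Y * card F" using False by (intro mult_right_mono) auto
  ultimately have "\<not> card F \<le> Suc r" using * by (auto simp: min_def)
  then show ?thesis using * by (simp add: min_def)
qed auto

end

section \<open>Meager sets and the property of Baire\<close>

lemma meager_mono:
  assumes "meager S" "T \<subseteq> S"
  shows "meager T"
proof -
  obtain N :: "nat \<Rightarrow> 'a set" where N: "\<And>n. nowhere_dense (N n)" "S = (\<Union>n. N n)"
    using assms(1) by (auto simp: meager_def)
  have "nowhere_dense (N n \<inter> T)" for n
    using N(1)[of n] interior_mono[OF closure_mono[of "N n \<inter> T" "N n"]]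
    by (auto simp: nowhere_dense_def)
  moreover have "T = (\<Union>n. N n \<inter> T)" using assms(2) N(2) by blast
  ultimately show ?thesis unfolding meager_def by (intro exI[of _ "\<lambda>n. N n \<inter> T"]) blast
qed

lemma meager_nowhere_dense: "nowhere_dense S \<Longrightarrow> meager S"
  unfolding meager_def by (intro exI[of _ "\<lambda>_. S"]) simp

lemma meager_empty [simp]: "meager {}"
  by (rule meager_nowhere_dense) (simp add: nowhere_dense_def)

lemma meager_UN_nat:
  fixes S :: "nat \<Rightarrow> 'a::topological_space set"
  assumes "\<And>n. meager (S n)"
  shows "meager (\<Union>n. S n)"
proof -
  have "\<forall>n. \<exists>N :: nat \<Rightarrow> 'a set. (\<forall>k. nowhere_dense (N k)) \<and> S n = (\<Union>k. N k)"
    using assms by (simp add: meager_def)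
  then obtain N :: "nat \<Rightarrow> nat \<Rightarrow> 'a set"
    where N: "\<And>n k. nowhere_dense (N n k)" "\<And>n. S n = (\<Union>k. N n k)" by metis
  have "(\<Union>n. S n) = (\<Union>m. N (fst (prod_decode m)) (snd (prod_decode m)))"
  proof (intro equalityI subsetI)
    fix x assume "x \<in> (\<Union>n. S n)"
    then obtain n k where "x \<in> N n k" using N(2) by blast
    then show "x \<in> (\<Union>m. N (fst (prod_decode m)) (snd (prod_decode m)))"
      by (intro UN_I[of "prod_encode (n, k)"]) auto
  qed (use N(2) in blast)
  then show ?thesis
    unfolding meager_def using N(1)
    by (intro exI[of _ "\<lambda>m. N (fst (prod_decode m)) (snd (prod_decode m))"]) simp
qed

lemma meager_UN:
  assumes "countable I" "\<And>i. i \<in> I \<Longrightarrow> meager (S i)"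
  shows "meager (\<Union>i\<in>I. S i)"
proof (cases "I = {}")
  case False
  have m: "meager (\<Union>n::nat. S (from_nat_into I n))"
    by (rule meager_UN_nat) (rule assms(2)[OF from_nat_into[OF False]])
  have "(\<Union>n::nat. S (from_nat_into I n)) = (\<Union>i\<in>range (from_nat_into I). S i)"
    by simp
  then have "(\<Union>n::nat. S (from_nat_into I n)) = (\<Union>i\<in>I. S i)"
    unfolding range_from_nat_into[OF False assms(1)] .
  with m show ?thesis by simp
qed simp

lemma meager_Un: "meager S \<Longrightarrow> meager T \<Longrightarrow> meager (S \<union> T)"
  using meager_UN[of "{S, T}" "\<lambda>X. X"] by auto

text \<open>
  The Baire category theorem.
\<close>

lemma meager_open_empty:
  fixes U :: "'x::polish_space set"
  assumes "open U" "meager U"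
  shows "U = {}"
proof -
  obtain N :: "nat \<Rightarrow> 'x set" where N: "\<And>n. nowhere_dense (N n)" "U = (\<Union>n. N n)"
    using assms(2) by (auto simp: meager_def)
  have "(euclidean :: 'x topology) interior_of (\<Union>(range (\<lambda>n. closure (N n)))) = {}"
  proof (rule Baire_category_alt)
    show "completely_metrizable_space (euclidean :: 'x topology) \<or>
        locally_compact_space (euclidean :: 'x topology) \<and> regular_space (euclidean :: 'x topology)"
      using completely_metrizable_space_euclidean by blast
    show "closedin euclidean T \<and> euclidean interior_of T = {}"
      if "T \<in> range (\<lambda>n. closure (N n))" for T
      using that N(1) by (auto simp: nowhere_dense_def)
  qed simp
  then have "interior (\<Union>n. closure (N n)) = {}" by simp
  moreover have "U \<subseteq> (\<Union>n. closure (N n))" using N(2) closure_subset by blast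
  ultimately show ?thesis using assms(1) by (metis interior_maximal subset_empty)
qed

lemma baire_property_setsI:
  "open U \<Longrightarrow> meager M \<Longrightarrow> A - U \<subseteq> M \<Longrightarrow> U - A \<subseteq> M \<Longrightarrow> A \<in> baire_property_sets"
  unfolding baire_property_sets_def using meager_mono[of M "(A - U) \<union> (U - A)"] by blast

lemma baire_property_setsE:
  assumes "A \<in> baire_property_sets"
  obtains U where "open U" "meager ((A - U) \<union> (U - A))"
  using assms by (auto simp: baire_property_sets_def)

lemma baire_property_open: "open U \<Longrightarrow> U \<in> baire_property_sets"
  by (rule baire_property_setsI[of U "{}"]) auto

lemma baire_property_meager: "meager M \<Longrightarrow> M \<in> baire_property_sets"
  by (rule baire_property_setsI[of "{}" M]) auto

lemma nowhere_dense_boundary: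
  assumes "open U"
  shows "nowhere_dense (closure U - U)"
proof -
  have "closed (closure U - U)" using assms by (intro closed_Diff) auto
  moreover have "interior (closure U - U) \<inter> closure U = {}"
    using interior_subset[of "closure U - U"] by (subst open_Int_closure_eq_empty) auto
  ultimately show ?thesis using interior_subset[of "closure U - U"]
    by (auto simp: nowhere_dense_def closure_closed)
qed

lemma baire_property_Compl:
  assumes "A \<in> baire_property_sets"
  shows "- A \<in> baire_property_sets"
proof -
  obtain U where U: "open U" "meager ((A - U) \<union> (U - A))"
    using assms by (rule baire_property_setsE)
  show ?thesis
  proof (rule baire_property_setsI)
    show "open (- closure U)" by (rule open_Compl[OF closed_closure])
    show "meager ((closure U - U) \<union> ((A - U) \<union> (U - A)))"
      by (rule meager_Un[OF meager_nowhere_dense[OF nowhere_dense_boundary[OF U(1)]] U(2)])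
    show "- closure U - - A \<subseteq> (closure U - U) \<union> ((A - U) \<union> (U - A))"
      using closure_subset[of U] by blast
  qed blast
qed

lemma sigma_algebra_baire_property: "sigma_algebra UNIV (baire_property_sets :: 'x::topological_space set set)"
  unfolding sigma_algebra_iff2
proof (intro conjI ballI allI impI)
  show "{} \<in> (baire_property_sets :: 'x set set)" by (rule baire_property_meager) simp
  fix S :: "'x set" assume "S \<in> baire_property_sets"
  then show "UNIV - S \<in> baire_property_sets" using baire_property_Compl[of S] by (simp add: Compl_eq_Diff_UNIV)
next
  fix S :: "nat \<Rightarrow> 'x set" assume S: "range S \<subseteq> baire_property_sets"
  then have "\<forall>n. \<exists>U. open U \<and> meager ((S n - U) \<union> (U - S n))"
    by (auto simp: baire_property_sets_def)
  then obtain U where U: "\<And>n. open (U n)" "\<And>n. meager ((S n - U n) \<union> (U n - S n))" by metis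
  show "(\<Union>n. S n) \<in> baire_property_sets"
  proof (rule baire_property_setsI)
    show "open (\<Union>n. U n)" using U by blast
    show "meager (\<Union>n. (S n - U n) \<union> (U n - S n))" using U(2) by (rule meager_UN_nat)
  qed blast+
qed simp

definition baire_algebra :: "'x::topological_space measure" where
  "baire_algebra = sigma UNIV baire_property_sets"

lemma space_baire_algebra [simp]: "space baire_algebra = UNIV"
  by (simp add: baire_algebra_def)

lemma sets_baire_algebra: "sets baire_algebra = baire_property_sets"
  unfolding baire_algebra_def
  by (simp add: sigma_algebra.sigma_sets_eq[OF sigma_algebra_baire_property])

lemma borel_subset_baire_algebra: "sets borel \<subseteq> sets baire_algebra"
  unfolding borel_def sets_baire_algebra
  using sigma_algebra.sigma_sets_subset[OF sigma_algebra_baire_property, of "{S. open S}"]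
    baire_property_open by auto

text \<open>
  A set with the property of Baire differs from an open set \<open>U\<close> by a meager set. The preimage of \<open>U\<close> is
  Borel, and the preimage of the difference is meager by hypothesis.
\<close>

lemma measurable_baire_algebra:
  fixes f :: "'x::topological_space \<Rightarrow> 'x"
  assumes bij: "bij f" and borel: "f \<in> borel \<rightarrow>\<^sub>M borel"
    and meager: "\<And>M. meager M \<Longrightarrow> meager (f -` M)"
  shows "f \<in> baire_algebra \<rightarrow>\<^sub>M baire_algebra"
proof (rule measurableI)
  fix A :: "'x set" assume "A \<in> sets baire_algebra"
  then obtain U where U: "open U" "meager ((A - U) \<union> (U - A))"
    unfolding sets_baire_algebra by (rule baire_property_setsE)
  have M: "f -` ((A - U) \<union> (U - A)) \<in> sets baire_algebra"
    "f -` (U - A) \<in> sets baire_algebra"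
    unfolding sets_baire_algebra
    by (intro baire_property_meager meager meager_mono[OF U(2)]; blast)+
  have "f -` U \<in> sets borel" using measurable_sets[OF borel, of U] U(1) by simp
  then have "f -` U \<in> sets baire_algebra" using borel_subset_baire_algebra by blast
  then have "(f -` U - f -` (U - A)) \<union> (f -` ((A - U) \<union> (U - A)) - f -` (U - A)) \<in> sets baire_algebra"
    using M by (intro sets.Un sets.Diff)
  moreover have "f -` A = (f -` U - f -` (U - A)) \<union> (f -` ((A - U) \<union> (U - A)) - f -` (U - A))" by blast
  ultimately show "f -` A \<inter> space baire_algebra \<in> sets baire_algebra" by simp
qed simp

section \<open>Spread-out sets with comeager union\<close>

text \<open>
  Up to a meager set, the complement of \<open>D\<close> is an open set, in which \<open>D\<close> is meager.
\<close>

lemma comeager_if_nonmeager_everywhere: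
  fixes D :: "'x::polish_space set"
  assumes D: "D \<in> baire_property_sets"
    and basis: "topological_basis \<B>"
    and nonmeager: "\<And>V. V \<in> \<B> \<Longrightarrow> V \<noteq> {} \<Longrightarrow> \<not> meager (D \<inter> V)"
  shows "meager (- D)"
proof -
  obtain U where U: "open U" "meager ((- D - U) \<union> (U - - D))"
    using baire_property_Compl[OF D] by (rule baire_property_setsE)
  have "U = {}"
  proof (rule ccontr)
    assume "U \<noteq> {}"
    then obtain V where V: "V \<in> \<B>" "V \<subseteq> U" "V \<noteq> {}"
      using topological_basisE[OF basis U(1)] by (metis ex_in_conv)
    have "meager (D \<inter> V)" by (rule meager_mono[OF U(2)]) (use V in blast)
    then show False using nonmeager V by blast
  qed
  then show ?thesis using U(2) by simp
qed

text \<open>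
  Around every \<open>x\<close> there is a basic open set \<open>U k\<close> that avoids the finitely many points \<open>\<phi> x\<close> different
  from \<open>x\<close>. The points for which \<open>U k\<close> works form the set \<open>C k\<close>.
\<close>

lemma countable_spread_out_cover:
  fixes \<Phi> :: "('x::polish_space \<Rightarrow> 'x) set"
  assumes fin: "finite \<Phi>" and meas: "\<And>\<phi>. \<phi> \<in> \<Phi> \<Longrightarrow> \<phi> \<in> borel \<rightarrow>\<^sub>M borel"
  shows "\<exists>C :: nat \<Rightarrow> 'x set. (\<forall>k. C k \<in> sets borel) \<and> (\<Union>k. C k) = UNIV \<and>
           (\<forall>k. \<forall>x\<in>C k. \<forall>\<phi>\<in>\<Phi>. \<phi> x \<in> C k \<longrightarrow> \<phi> x = x)"
proof -
  obtain \<B> :: "'x set set" where \<B>: "countable \<B>" "topological_basis \<B>"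
    using ex_countable_basis by blast
  have "\<B> \<noteq> {}" using \<B>(2) by (metis UNIV_I empty_iff open_UNIV topological_basisE)
  then have rng: "range (from_nat_into \<B>) = \<B>" using \<B>(1) by simp
  define U where "U = from_nat_into \<B>"
  have openU: "open (U k)" for k
    using topological_basis_open[OF \<B>(2)] rng unfolding U_def by blast
  define C where "C k = U k \<inter> (\<Inter>\<phi>\<in>\<Phi>. {x. \<phi> x = x} \<union> (- (\<phi> -` U k)))" for k
  have "C k \<in> sets borel" for k
  proof -
    have "{x. \<phi> x = x} \<union> (- (\<phi> -` U k)) \<in> sets borel" if "\<phi> \<in> \<Phi>" for \<phi>
    proof -
      have "{x \<in> space borel. \<phi> x = x} \<in> sets borel"
        using meas[OF that] by (intro measurable_equality_set) auto
      moreover have "\<phi> -` U k \<in> sets borel"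
        using measurable_sets[OF meas[OF that], of "U k"] openU by simp
      ultimately show ?thesis by (intro sets.Un borel_comp) auto
    qed
    then have "(\<Inter>\<phi>\<in>\<Phi>. {x. \<phi> x = x} \<union> (- (\<phi> -` U k))) \<in> sets borel"
      using fin by (cases "\<Phi> = {}") (auto intro!: sets.finite_INT)
    then show ?thesis unfolding C_def using openU by (intro sets.Int) auto
  qed
  moreover have "(\<Union>k. C k) = UNIV"
  proof -
    have "\<exists>k. x \<in> C k" for x
    proof -
      let ?Y = "{\<phi> x |\<phi>. \<phi> \<in> \<Phi>} - {x}"
      have "finite ?Y" using fin by simp
      then have "open (- ?Y)" by (rule open_Compl[OF finite_imp_closed])
      then obtain V where V: "V \<in> \<B>" "x \<in> V" "V \<subseteq> - ?Y"
        using topological_basisE[OF \<B>(2), of "- ?Y" x] by blast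
      obtain k where "V = U k" using V(1) rng unfolding U_def by blast
      then have "x \<in> C k" using V by (auto simp: C_def)
      then show ?thesis by blast
    qed
    then show ?thesis by blast
  qed
  moreover have "\<phi> x = x" if "x \<in> C k" "\<phi> \<in> \<Phi>" "\<phi> x \<in> C k" for k x \<phi>
    using that by (auto simp: C_def)
  ultimately show ?thesis by (intro exI[of _ C]) blast
qed

text \<open>
  Countably many spread-out Borel sets cover the space. By the Baire category theorem, one of them is
  nonmeager in the \<open>n\<close>-th basic open set, and \<open>S n\<close> is taken to be that one. Then the union of all
  \<open>S n\<close> is nonmeager in every basic open set, hence comeager.
\<close>

lemma generic_spread_out_sets:
  fixes E :: "('x::polish_space \<Rightarrow> 'x) set" and L :: "nat \<Rightarrow> nat"
  assumes fin: "finite E" and meas: "\<And>e. e \<in> E \<Longrightarrow> e \<in> borel \<rightarrow>\<^sub>M borel"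
  shows "\<exists>S. (\<forall>n. S n \<in> sets borel \<and> spread_out E (L n) (S n)) \<and> meager (- (\<Union>n. S n))"
proof -
  obtain \<B> :: "'x set set" where \<B>: "countable \<B>" "topological_basis \<B>"
    using ex_countable_basis by blast
  have "\<B> \<noteq> {}" using \<B>(2) by (metis UNIV_I empty_iff open_UNIV topological_basisE)
  then have rng: "range (from_nat_into \<B>) = \<B>" using \<B>(1) by simp
  define V where "V = from_nat_into \<B>"
  have mw: "u \<in> borel \<rightarrow>\<^sub>M borel" if "u \<in> words E n" for u n
    using that
  proof (induction n arbitrary: u)
    case (Suc n)
    then obtain e w where u: "u = e \<circ> w" "e \<in> E" "w \<in> words E n" by (auto elim: words_SucE)
    show ?case unfolding u(1) by (rule measurable_comp[OF Suc.IH[OF u(3)] meas[OF u(2)]])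
  qed auto
  have "\<exists>S. S \<in> sets borel \<and> spread_out E (L n) S \<and> (V n \<noteq> {} \<longrightarrow> \<not> meager (S \<inter> V n))" for n
  proof -
    have "\<exists>C :: nat \<Rightarrow> 'x set. (\<forall>k. C k \<in> sets borel) \<and> (\<Union>k. C k) = UNIV \<and>
        (\<forall>k. \<forall>x\<in>C k. \<forall>\<phi>\<in>words E (L n). \<phi> x \<in> C k \<longrightarrow> \<phi> x = x)"
      by (rule countable_spread_out_cover[OF finite_words[OF fin]]) (rule mw)
    then obtain C :: "nat \<Rightarrow> 'x set" where C: "\<And>k. C k \<in> sets borel" "(\<Union>k. C k) = UNIV"
      and C': "\<forall>k. \<forall>x\<in>C k. \<forall>\<phi>\<in>words E (L n). \<phi> x \<in> C k \<longrightarrow> \<phi> x = x" by auto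
    have "spread_out E (L n) (C k)" for k
      unfolding spread_out_def near_def
    proof (intro ballI impI, elim bexE)
      fix x y \<phi> assume x: "x \<in> C k" "y \<in> C k" "\<phi> \<in> words E (L n)" "\<phi> x = y"
      from C'[rule_format, OF x(1,3)] x(2,4) show "x = y" by simp
    qed
    moreover have "\<exists>k. V n \<noteq> {} \<longrightarrow> \<not> meager (C k \<inter> V n)"
    proof (rule ccontr)
      assume "\<nexists>k. V n \<noteq> {} \<longrightarrow> \<not> meager (C k \<inter> V n)"
      then have ne: "V n \<noteq> {}" and "\<And>k. meager (C k \<inter> V n)" by blast+
      then have "meager (\<Union>k. C k \<inter> V n)" by (intro meager_UN_nat)
      moreover have "(\<Union>k. C k \<inter> V n) = V n" using C(2) by blast
      moreover have "open (V n)"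
        using topological_basis_open[OF \<B>(2)] rng unfolding V_def by blast
      ultimately show False using meager_open_empty ne by metis
    qed
    ultimately show ?thesis using C(1) by blast
  qed
  then obtain S where S: "\<And>n. S n \<in> sets borel" "\<And>n. spread_out E (L n) (S n)"
    "\<And>n. V n \<noteq> {} \<Longrightarrow> \<not> meager (S n \<inter> V n)" by metis
  have "meager (- (\<Union>n. S n))"
  proof (rule comeager_if_nonmeager_everywhere[OF _ \<B>(2)])
    have "(\<Union>n. S n) \<in> sets borel" using S(1) by auto
    then show "(\<Union>n. S n) \<in> baire_property_sets"
      using borel_subset_baire_algebra unfolding sets_baire_algebra by blast
    fix W assume W: "W \<in> \<B>" "W \<noteq> {}"
    then obtain n where n: "W = V n" using rng unfolding V_def by blast
    show "\<not> meager ((\<Union>n. S n) \<inter> W)"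
    proof
      assume "meager ((\<Union>n. S n) \<inter> W)"
      then have "meager (S n \<inter> V n)" by (rule meager_mono) (use n in blast)
      then show False using S(3) W n by blast
    qed
  qed
  then show ?thesis using S by blast
qed

section \<open>Matchings with the property of Baire\<close>

lemma measurable_choice:
  assumes "finite E" and A: "A \<in> sets M"
    and P: "\<And>e. e \<in> E \<Longrightarrow> {x \<in> A. P e x} \<in> sets M"
    and ex: "\<And>x. x \<in> A \<Longrightarrow> \<exists>e\<in>E. P e x"
  shows "\<exists>c. (\<forall>x\<in>A. c x \<in> E \<and> P (c x) x) \<and> (\<forall>e\<in>E. {x \<in> A. c x = e} \<in> sets M)"
  using assms
proof (induction E arbitrary: A rule: finite_induct)
  case empty
  then have "A = {}" by auto
  then show ?case by simp
next
  case (insert e E)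
  define A0 where "A0 = {x \<in> A. P e x}"
  have A0: "A0 \<in> sets M" unfolding A0_def by (rule insert.prems(2)) simp
  have A1: "A - A0 \<in> sets M" using insert.prems(1) A0 by (rule sets.Diff)
  have "\<exists>c. (\<forall>x\<in>A - A0. c x \<in> E \<and> P (c x) x) \<and> (\<forall>e\<in>E. {x \<in> A - A0. c x = e} \<in> sets M)"
  proof (rule insert.IH[OF A1])
    fix e' assume "e' \<in> E"
    then have "{x \<in> A. P e' x} - A0 \<in> sets M" using insert.prems(2)[of e'] A0 by auto
    moreover have "{x \<in> A. P e' x} - A0 = {x \<in> A - A0. P e' x}" by auto
    ultimately show "{x \<in> A - A0. P e' x} \<in> sets M" by simp
  next
    fix x assume "x \<in> A - A0"
    then show "\<exists>e\<in>E. P e x" using insert.prems(3)[of x] by (auto simp: A0_def)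
  qed
  then obtain c where c: "\<forall>x\<in>A - A0. c x \<in> E \<and> P (c x) x"
    "\<forall>e\<in>E. {x \<in> A - A0. c x = e} \<in> sets M" by auto
  define d where "d x = (if x \<in> A0 then e else c x)" for x
  have "\<forall>x\<in>A. d x \<in> insert e E \<and> P (d x) x"
    using c(1) by (auto simp: d_def A0_def)
  moreover have "{x \<in> A. d x = e'} \<in> sets M" if "e' \<in> insert e E" for e'
  proof (cases "e' = e")
    case True
    have "{x \<in> A. d x = e} = A0" using c(1) insert.hyps(2) by (auto simp: d_def A0_def)
    then show ?thesis using A0 True by simp
  next
    case False
    then have "{x \<in> A. d x = e'} = {x \<in> A - A0. c x = e'}" by (auto simp: d_def)
    then show ?thesis using c(2) that False by auto
  qed
  ultimately show ?case by (intro exI[of _ d]) simp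
qed

locale generic_maps = symmetric_maps E for E :: "('x::polish_space \<Rightarrow> 'x) set" +
  assumes borel_E: "\<And>e. e \<in> E \<Longrightarrow> e \<in> borel \<rightarrow>\<^sub>M borel"
    and meager_E: "\<And>e M. e \<in> E \<Longrightarrow> meager M \<Longrightarrow> meager (e -` M)"
begin

lemma bij_E: assumes "e \<in> E" shows "bij e"
proof -
  obtain e' where "e' \<circ> e = id" "e \<circ> e' = id" using inverse_E[OF assms] by blast
  then show ?thesis by (rule o_bij)
qed

lemma baire_E: "e \<in> E \<Longrightarrow> e \<in> baire_algebra \<rightarrow>\<^sub>M baire_algebra"
  by (rule measurable_baire_algebra[OF bij_E borel_E meager_E])

lemma baire_words: "u \<in> words E n \<Longrightarrow> u \<in> baire_algebra \<rightarrow>\<^sub>M baire_algebra"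
proof (induction n arbitrary: u)
  case 0
  then show ?case by simp
next
  case (Suc n)
  then obtain e w where u: "u = e \<circ> w" "e \<in> E" "w \<in> words E n" by (auto elim: words_SucE)
  show ?case unfolding u(1) by (rule measurable_comp[OF Suc.IH[OF u(3)] baire_E[OF u(2)]])
qed

lemma meager_words: "u \<in> words E n \<Longrightarrow> meager M \<Longrightarrow> meager (u -` M)"
proof (induction n arbitrary: u M)
  case 0
  then show ?case by simp
next
  case (Suc n)
  from Suc.prems(1) obtain e w where u: "u = e \<circ> w" "e \<in> E" "w \<in> words E n" by (rule words_SucE)
  show ?case unfolding u(1) vimage_comp[symmetric]
    by (rule Suc.IH[OF u(3) meager_E[OF u(2) Suc.prems(2)]])
qed

lemma pred_mem_words:
  assumes "u \<in> words E n" "S \<in> sets baire_algebra"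
  shows "Measurable.pred baire_algebra (\<lambda>x. u x \<in> S)"
  using measurable_sets[OF baire_words[OF assms(1)] assms(2)]
  by (simp add: pred_def vimage_def)

lemma borel_words: assumes "u \<in> words E n" shows "u \<in> baire_algebra \<rightarrow>\<^sub>M borel"
proof -
  have "id \<in> baire_algebra \<rightarrow>\<^sub>M (borel :: 'x measure)"
    using borel_subset_baire_algebra by (intro measurableI) auto
  from measurable_comp[OF baire_words[OF assms] this] show ?thesis by simp
qed

lemma pred_eq_words:
  assumes "u \<in> words E m" "v \<in> words E n"
  shows "Measurable.pred baire_algebra (\<lambda>x. u x = v x)"
  using measurable_equality_set[OF borel_words[OF assms(1)] borel_words[OF assms(2)]]
  by (simp add: pred_def)

lemma sets_eq_E:
  assumes "e \<in> E" "e' \<in> E"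
  shows "{x. e x = e' x} \<in> sets baire_algebra"
proof -
  have "e \<in> words E 1" "e' \<in> words E 1" using assms unfolding words_1 .
  from pred_eq_words[OF this] show ?thesis by (simp add: pred_def)
qed

lemma image_E:
  assumes e: "e \<in> E" and Y: "Y \<in> sets baire_algebra"
  shows "e ` Y \<in> sets baire_algebra"
proof -
  obtain e' where e': "e' \<in> E" "e' \<circ> e = id" "e \<circ> e' = id" using inverse_E[OF e] by blast
  have 1: "e' (e x) = x" and 2: "e (e' x) = x" for x
    using fun_cong[OF e'(2), of x] fun_cong[OF e'(3), of x] by simp_all
  have "e ` Y = e' -` Y"
  proof (intro equalityI subsetI)
    fix y assume "y \<in> e' -` Y"
    then have "e (e' y) \<in> e ` Y" by simp
    then show "y \<in> e ` Y" unfolding 2 .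
  qed (auto simp: 1)
  then show ?thesis using measurable_sets[OF baire_E[OF e'(1)] Y] by simp
qed

text \<open>
  A set that violates Hall's condition after the removal of the edge from \<open>x\<close> to \<open>e x\<close> can be chosen
  connected, and it must have \<open>e x\<close> as a neighbour. So it lies in a ball around \<open>x\<close>, and both the set
  and its remaining neighbours can be named by finite sets \<open>U\<close> and \<open>R\<close> of words applied to \<open>x\<close>, without
  repetition in \<open>U\<close>. This makes the condition a countable combination of Baire measurable conditions
  on \<open>x\<close>.
\<close>

lemma hall_remove_edge_fails_iff:
  assumes hall: "hall E A B" and e: "e \<in> E"
  shows "\<not> hall E (A - {x}) (B - {e x}) \<longleftrightarrow>
    (\<exists>N. \<exists>U\<in>Pow (words E N). \<exists>R\<in>Pow (words E (Suc N)). card R < card U \<and>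
      (\<forall>u\<in>U. \<forall>v\<in>U. u x = v x \<longrightarrow> u = v) \<and> (\<forall>u\<in>U. u x \<in> A \<and> u x \<noteq> id x) \<and>
      (\<forall>u\<in>U. \<forall>d\<in>E. (d \<circ> u) x \<in> B \<longrightarrow> (d \<circ> u) x = e x \<or> (\<exists>r\<in>R. r x = (d \<circ> u) x)))"
    (is "_ \<longleftrightarrow> (\<exists>N. \<exists>U\<in>Pow (words E N). \<exists>R\<in>Pow (words E (Suc N)). ?Q U R)")
proof
  assume "\<not> hall E (A - {x}) (B - {e x})"
  then obtain F where F: "finite F" "F \<subseteq> A - {x}" "unsplit E F"
    and small: "card (moves E F \<inter> (B - {e x})) < card F"
    using hall_if_unsplit[OF finite_E, of "A - {x}" "B - {e x}"] by (meson not_le)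
  have "F \<subseteq> A" using F(2) by blast
  then have "card F \<le> card (moves E F \<inter> B)" by (rule hallD[OF hall F(1)])
  with small have lt: "card (moves E F \<inter> (B - {e x})) < card (moves E F \<inter> B)" by linarith
  have "e x \<in> moves E F"
  proof (rule ccontr)
    assume "e x \<notin> moves E F"
    then have "moves E F \<inter> (B - {e x}) = moves E F \<inter> B" by blast
    then show False using lt by simp
  qed
  then obtain z d where z: "z \<in> F" "d \<in> E" "e x = d z" unfolding moves_def by blast
  have xz: "near E (1 + 1) x z"
    by (rule near_trans[OF near_move[OF e] near_sym[OF near_move[OF z(2), of z, folded z(3)]]])
  have "card F \<le> card {w \<in> F. near E (2 * card F) z w}"
    using card_near_unsplit[OF F(1,3) z(1), of "card F"] by simp
  then have "{w \<in> F. near E (2 * card F) z w} = F" using F(1) by (intro card_seteq) auto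
  then have zw: "near E (2 * card F) z w" if "w \<in> F" for w using that by blast
  define N where "N = 1 + 1 + 2 * card F"
  have "F \<subseteq> (\<lambda>u. u x) ` words E N"
  proof
    fix w assume "w \<in> F"
    then have "near E N x w" using near_trans[OF xz zw[of w]] unfolding N_def by simp
    then show "w \<in> (\<lambda>u. u x) ` words E N" unfolding near_def by auto
  qed
  then obtain U where U: "U \<subseteq> words E N" "inj_on (\<lambda>u. u x) U" "F = (\<lambda>u. u x) ` U"
    unfolding subset_image_inj by auto
  have "moves E F \<inter> (B - {e x}) \<subseteq> (\<lambda>u. u x) ` words E (Suc N)"
  proof
    fix w assume "w \<in> moves E F \<inter> (B - {e x})"
    then obtain u d where "u \<in> U" "d \<in> E" "w = (d \<circ> u) x" unfolding moves_def U(3) by auto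
    then show "w \<in> (\<lambda>u. u x) ` words E (Suc N)"
      using words_SucI[of d E u N] U(1) by blast
  qed
  then obtain R where R: "R \<subseteq> words E (Suc N)" "inj_on (\<lambda>u. u x) R"
    "moves E F \<inter> (B - {e x}) = (\<lambda>u. u x) ` R"
    unfolding subset_image_inj by auto
  have "card R < card U"
    using small unfolding R(3) unfolding U(3) card_image[OF U(2)] card_image[OF R(2)] .
  moreover have "\<forall>u\<in>U. \<forall>v\<in>U. u x = v x \<longrightarrow> u = v" using U(2) by (simp add: inj_on_def)
  moreover have "\<forall>u\<in>U. u x \<in> A \<and> u x \<noteq> id x" using F(2) unfolding U(3) by auto
  moreover have "(d \<circ> u) x = e x \<or> (\<exists>r\<in>R. r x = (d \<circ> u) x)"
    if "u \<in> U" "d \<in> E" "(d \<circ> u) x \<in> B" for u d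
  proof -
    have "(d \<circ> u) x \<in> moves E F" using that unfolding moves_def U(3) by auto
    then have "(d \<circ> u) x = e x \<or> (d \<circ> u) x \<in> moves E F \<inter> (B - {e x})" using that by blast
    then show ?thesis unfolding R(3) by auto
  qed
  ultimately have "?Q U R" by simp
  then show "\<exists>N. \<exists>U\<in>Pow (words E N). \<exists>R\<in>Pow (words E (Suc N)). ?Q U R"
    using U(1) R(1) by blast
next
  assume "\<exists>N. \<exists>U\<in>Pow (words E N). \<exists>R\<in>Pow (words E (Suc N)). ?Q U R"
  then obtain N U R where U: "U \<subseteq> words E N" and R: "R \<subseteq> words E (Suc N)" and Q: "?Q U R"
    by blast
  have finU: "finite U" using finite_subset[OF U finite_words[OF finite_E]] .
  have finR: "finite R" using finite_subset[OF R finite_words[OF finite_E]] .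
  let ?F = "(\<lambda>u. u x) ` U"
  have "card ?F = card U" using Q by (intro card_image) (simp add: inj_on_def)
  moreover have "moves E ?F \<inter> (B - {e x}) \<subseteq> (\<lambda>u. u x) ` R"
  proof
    fix w assume "w \<in> moves E ?F \<inter> (B - {e x})"
    then obtain u d where u: "u \<in> U" "d \<in> E" "w = (d \<circ> u) x" "w \<in> B" "w \<noteq> e x"
      unfolding moves_def by auto
    from Q have "\<forall>u\<in>U. \<forall>d\<in>E. (d \<circ> u) x \<in> B \<longrightarrow> (d \<circ> u) x = e x \<or> (\<exists>r\<in>R. r x = (d \<circ> u) x)"
      by (elim conjE)
    from this[rule_format, OF u(1,2)] u(3-5) have "\<exists>r\<in>R. r x = w" by metis
    then show "w \<in> (\<lambda>u. u x) ` R" by blast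
  qed
  then have "card (moves E ?F \<inter> (B - {e x})) \<le> card R"
    using finR by (meson card_image_le card_mono finite_imageI le_trans)
  ultimately have "card (moves E ?F \<inter> (B - {e x})) < card ?F" using Q by simp
  moreover have "?F \<subseteq> A - {x}" using Q by auto
  ultimately show "\<not> hall E (A - {x}) (B - {e x})"
    using hallD[of E "A - {x}" "B - {e x}" ?F] finU by auto
qed

lemma sets_hall_remove_edge:
  assumes hall: "hall E A B" and e: "e \<in> E"
    and A: "A \<in> sets baire_algebra" and B: "B \<in> sets baire_algebra"
  shows "{x. hall E (A - {x}) (B - {e x})} \<in> sets baire_algebra"
proof -
  have e1: "e \<in> words E 1" using e unfolding words_1 .
  have "Measurable.pred baire_algebra (\<lambda>x. \<not> hall E (A - {x}) (B - {e x}))"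
    unfolding hall_remove_edge_fails_iff[OF hall e]
  proof (intro pred_intros_countable pred_intros_finite(4) finite_Pow_iff[THEN iffD2]
      finite_words finite_E)
    fix N U R assume U: "U \<in> Pow (words E N)" and R: "R \<in> Pow (words E (Suc N))"
    have finU: "finite U" using U finite_subset[OF _ finite_words[OF finite_E]] by blast
    have finR: "finite R" using R finite_subset[OF _ finite_words[OF finite_E]] by blast
    have u: "u \<in> words E N" if "u \<in> U" for u using U that by blast
    have r: "u \<in> words E (Suc N)" if "u \<in> R" for u using R that by blast
    have du: "d \<circ> u \<in> words E (Suc N)" if "u \<in> U" "d \<in> E" for u d
      by (rule words_SucI[OF that(2) u[OF that(1)]])
    have i: "id \<in> words E 0" by simp
    show "Measurable.pred baire_algebra (\<lambda>x. card R < card U \<and>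
      (\<forall>u\<in>U. \<forall>v\<in>U. u x = v x \<longrightarrow> u = v) \<and> (\<forall>u\<in>U. u x \<in> A \<and> u x \<noteq> id x) \<and>
      (\<forall>u\<in>U. \<forall>d\<in>E. (d \<circ> u) x \<in> B \<longrightarrow> (d \<circ> u) x = e x \<or> (\<exists>r\<in>R. r x = (d \<circ> u) x)))"
      by (intro pred_intros_logic(2-5) pred_intros_finite(3,4) finU finR finite_E measurable_const
          pred_eq_words[OF u u] pred_mem_words[OF u A] pred_eq_words[OF u i]
          pred_mem_words[OF du B] pred_eq_words[OF du e1] pred_eq_words[OF r du]) simp_all
  qed
  then have "{x \<in> space baire_algebra. \<not> \<not> hall E (A - {x}) (B - {e x})} \<in> sets baire_algebra"
    unfolding pred_def by (rule sets.sets_Collect_neg)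
  then show ?thesis by simp
qed

text \<open>
  The situation before stage \<open>n\<close>: \<open>A'\<close> is the set of points still to be matched, and \<open>B - B'\<close> consists
  of the points already used. Stage \<open>i\<close> uses at most \<open>1 + |F| / 2 ^ (i + 2)\<close> neighbours of a connected
  set \<open>F\<close>, and the sum over \<open>i < n\<close> is the bound below. It never exceeds \<open>n + |F| / 2\<close>.
\<close>

definition matching_state :: "'x set \<Rightarrow> nat \<Rightarrow> 'x set \<Rightarrow> 'x set \<Rightarrow> bool" where
  "matching_state B n A' B' \<longleftrightarrow>
     A' \<in> sets baire_algebra \<and> B' \<in> sets baire_algebra \<and> B' \<subseteq> B \<and> hall E A' B' \<and>
     (\<forall>F. finite F \<and> unsplit E F \<longrightarrow>
        real (card (moves E F \<inter> (B - B'))) \<le> n + card F * (1 - 1 / 2 ^ n) / 2)"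

text \<open>
  Hall's condition for \<open>A' - S\<close> is tested on a connected finite set \<open>F\<close>. If \<open>F\<close> loses at most one
  neighbour, then it is covered by the choice of the corresponding edge. If it loses at least two
  neighbours, then \<open>card F \<ge> 2 * 2 ^ (n + 2) \<ge> 2 * (n + 1)\<close>, so that the total loss \<open>n + 1 + |F| / 2\<close>
  of all stages so far is at most \<open>|F|\<close>, and expansion leaves at least \<open>|F|\<close> neighbours.
\<close>

lemma matching_step:
  assumes exp: "\<And>F. finite F \<Longrightarrow> F \<subseteq> A' \<Longrightarrow> 2 * card F \<le> card (moves E F \<inter> B)"
    and st: "matching_state B n A' B'"
    and S: "S \<in> sets baire_algebra" "spread_out E (2 ^ (n + 4)) S"
  shows "\<exists>f. piecewise_injection E baire_algebra (S \<inter> A') B' f \<and> matching_state B (Suc n) (A' - S) (B' - f ` (S \<inter> A'))"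
proof -
  have A': "A' \<in> sets baire_algebra" and B': "B' \<in> sets baire_algebra" and B'B: "B' \<subseteq> B"
    and hall: "hall E A' B'"
    and removed: "\<And>F. finite F \<Longrightarrow> unsplit E F \<Longrightarrow>
        real (card (moves E F \<inter> (B - B'))) \<le> n + card F * (1 - 1 / 2 ^ n) / 2"
    using st unfolding matching_state_def by auto
  define X where "X = S \<inter> A'"
  have X: "X \<in> sets baire_algebra" unfolding X_def using S(1) A' by (rule sets.Int)
  have "\<exists>c. (\<forall>x\<in>X. c x \<in> E \<and> (c x x \<in> B' \<and> hall E (A' - {x}) (B' - {c x x}))) \<and>
      (\<forall>e\<in>E. {x \<in> X. c x = e} \<in> sets baire_algebra)"
  proof (rule measurable_choice[OF finite_E X])
    fix e assume e: "e \<in> E"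
    have "e -` B' \<in> sets baire_algebra" using measurable_sets[OF baire_E[OF e] B'] by simp
    then have "X \<inter> (e -` B' \<inter> {x. hall E (A' - {x}) (B' - {e x})}) \<in> sets baire_algebra"
      using X sets_hall_remove_edge[OF hall e A' B'] by (intro sets.Int)
    moreover have "X \<inter> (e -` B' \<inter> {x. hall E (A' - {x}) (B' - {e x})}) =
        {x \<in> X. e x \<in> B' \<and> hall E (A' - {x}) (B' - {e x})}" by auto
    ultimately show "{x \<in> X. e x \<in> B' \<and> hall E (A' - {x}) (B' - {e x})} \<in> sets baire_algebra"
      by simp
  next
    fix x assume "x \<in> X"
    then show "\<exists>e\<in>E. e x \<in> B' \<and> hall E (A' - {x}) (B' - {e x})"
      using hall_remove_edge[OF finite_E hall, of x] by (simp add: X_def)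
  qed
  then obtain c where c: "\<forall>x\<in>X. c x \<in> E \<and> (c x x \<in> B' \<and> hall E (A' - {x}) (B' - {c x x}))"
    and c_sets: "\<forall>e\<in>E. {x \<in> X. c x = e} \<in> sets baire_algebra" by (elim exE conjE)
  define f where "f x = c x x" for x
  define Y where "Y = f ` X"
  have cE: "c x \<in> E" and fB: "f x \<in> B'" and fhall: "hall E (A' - {x}) (B' - {f x})" if "x \<in> X" for x
    using c that by (simp_all add: f_def)
  have move: "near E 1 x (f x)" if "x \<in> X" for x
    unfolding f_def by (rule near_move[OF cE[OF that]])
  \<comment> \<open>The matched points are one step away from \<open>S\<close> at either end, which turns the distance
    \<open>2 ^ (n + 4)\<close> into \<open>4 * r + 2\<close>.\<close>
  define r :: nat where "r = 2 ^ (n + 2) - 1"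
  have Suc_r: "Suc r = 2 ^ (n + 2)" by (simp add: r_def)
  have L: "1 + (4 * r + 2) + 1 = (2 ^ (n + 4) :: nat)"
  proof -
    have "1 + (4 * r + 2) + 1 = 4 * Suc r" by simp
    also have "\<dots> = 2 ^ (n + 4)" unfolding Suc_r by (simp add: power_add)
    finally show ?thesis .
  qed
  have eq_if_near: "x = x'" if x: "x \<in> X" "x' \<in> X" "near E (4 * r + 2) (f x) (f x')" for x x'
  proof -
    have "near E (1 + (4 * r + 2) + 1) x x'"
      by (rule near_trans[OF near_trans[OF move[OF x(1)] x(3)] near_sym[OF move[OF x(2)]]])
    then show ?thesis using S(2) x(1,2) unfolding L spread_out_def X_def by simp
  qed
  have injf: "inj_on f X"
  proof (rule inj_onI)
    fix x x' assume x: "x \<in> X" "x' \<in> X" "f x = f x'"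
    show "x = x'" by (rule eq_if_near[OF x(1,2)]) (simp only: x(3) near_refl)
  qed
  have spread_Y: "spread_out E (4 * r + 2) Y"
    unfolding spread_out_def Y_def
  proof (intro ballI impI, elim imageE)
    fix y y' x x' assume y: "near E (4 * r + 2) y y'" "y = f x" "x \<in> X" "y' = f x'" "x' \<in> X"
    have "x = x'" by (rule eq_if_near[OF y(3,5)]) (use y in simp)
    then show "y = y'" using y by simp
  qed
  have f_sets: "{x \<in> X. f x = e x} \<in> sets baire_algebra" if e: "e \<in> E" for e
  proof -
    have "(\<Union>d\<in>E. {x \<in> X. c x = d} \<inter> {x. d x = e x}) \<in> sets baire_algebra"
    proof (rule sets.finite_UN[OF finite_E])
      fix d assume d: "d \<in> E"
      show "{x \<in> X. c x = d} \<inter> {x. d x = e x} \<in> sets baire_algebra"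
        using c_sets d sets_eq_E[OF d e] by (intro sets.Int) simp_all
    qed
    moreover have "(\<Union>d\<in>E. {x \<in> X. c x = d} \<inter> {x. d x = e x}) = {x \<in> X. f x = e x}"
      using cE by (auto simp: f_def)
    ultimately show ?thesis by simp
  qed
  have pm: "piecewise_injection E baire_algebra X B' f"
    unfolding piecewise_injection_def using injf fB f_sets cE by (auto simp: f_def)
  have Y: "Y \<in> sets baire_algebra"
  proof -
    have "(\<Union>e\<in>E. e ` {x \<in> X. f x = e x}) \<in> sets baire_algebra"
      using f_sets image_E by (intro sets.finite_UN[OF finite_E]) simp
    moreover have "(\<Union>e\<in>E. e ` {x \<in> X. f x = e x}) = Y"
    proof (intro equalityI subsetI)
      fix y assume "y \<in> Y"
      then obtain x where x: "x \<in> X" "y = f x" by (auto simp: Y_def)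
      have "y \<in> c x ` {x' \<in> X. f x' = c x x'}" using x by (intro image_eqI[of _ _ x]) (auto simp: f_def)
      then show "y \<in> (\<Union>e\<in>E. e ` {x \<in> X. f x = e x})" using cE[OF x(1)] by blast
    next
      fix y assume "y \<in> (\<Union>e\<in>E. e ` {x \<in> X. f x = e x})"
      then obtain e x where "x \<in> X" "f x = e x" "y = e x" by blast
      then show "y \<in> Y" unfolding Y_def by (metis imageI)
    qed
    ultimately show ?thesis by simp
  qed
  have fin: "finite (moves E F \<inter> Z)" if "finite F" for F Z
    using finite_moves[OF finite_E that] by simp
  have removed': "real (card (moves E F \<inter> (B - (B' - Y)))) \<le> Suc n + card F * (1 - 1 / 2 ^ Suc n) / 2"
    and few: "card (moves E F \<inter> Y) \<le> 1 \<or> card (moves E F \<inter> Y) * 2 ^ (n + 2) \<le> card F"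
    if F: "finite F" "unsplit E F" for F
  proof -
    show *: "card (moves E F \<inter> Y) \<le> 1 \<or> card (moves E F \<inter> Y) * 2 ^ (n + 2) \<le> card F"
      using card_moves_spread_out[OF F spread_Y] unfolding Suc_r .
    have "real (card (moves E F \<inter> Y)) \<le> 1 + card F / 2 ^ (n + 2)"
      using *
    proof
      assume "card (moves E F \<inter> Y) \<le> 1"
      then have "real (card (moves E F \<inter> Y)) \<le> 1" by simp
      also have "\<dots> \<le> 1 + card F / 2 ^ (n + 2)" by simp
      finally show ?thesis .
    next
      assume "card (moves E F \<inter> Y) * 2 ^ (n + 2) \<le> card F"
      then have "real (card (moves E F \<inter> Y) * 2 ^ (n + 2)) \<le> real (card F)"
        by (rule of_nat_mono)
      then have "real (card (moves E F \<inter> Y)) \<le> card F / 2 ^ (n + 2)"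
        by (simp add: pos_le_divide_eq)
      then show ?thesis by simp
    qed
    moreover have "card (moves E F \<inter> (B - (B' - Y))) \<le> card ((moves E F \<inter> (B - B')) \<union> (moves E F \<inter> Y))"
      using fin[OF F(1)] by (intro card_mono) auto
    then have "card (moves E F \<inter> (B - (B' - Y))) \<le> card (moves E F \<inter> (B - B')) + card (moves E F \<inter> Y)"
      using card_Un_le le_trans by blast
    moreover note removed[OF F]
    ultimately have "real (card (moves E F \<inter> (B - (B' - Y)))) \<le>
        (n + card F * (1 - 1 / 2 ^ n) / 2) + (1 + card F / 2 ^ (n + 2))" by linarith
    also have "\<dots> = Suc n + card F * (1 - 1 / 2 ^ Suc n) / 2"
      by (simp add: field_simps power_add)
    finally show "real (card (moves E F \<inter> (B - (B' - Y)))) \<le> Suc n + card F * (1 - 1 / 2 ^ Suc n) / 2" .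
  qed
  have "hall E (A' - S) (B' - Y)"
  proof (rule hall_if_unsplit[OF finite_E])
    fix F assume F: "finite F" "F \<subseteq> A' - S" "unsplit E F"
    have FA: "F \<subseteq> A'" using F(2) by blast
    consider "card (moves E F \<inter> Y) = 0" | "card (moves E F \<inter> Y) = 1" | "card (moves E F \<inter> Y) \<ge> 2"
      by linarith
    then show "card F \<le> card (moves E F \<inter> (B' - Y))"
    proof cases
      case 1
      then have "moves E F \<inter> Y = {}" using fin[OF F(1), of Y] by (simp only: card_eq_0_iff) simp
      then have "moves E F \<inter> (B' - Y) = moves E F \<inter> B'" by blast
      then show ?thesis using hallD[OF hall F(1) FA] by simp
    next
      case 2
      then obtain y where y: "moves E F \<inter> Y = {y}" by (auto simp: card_1_singleton_iff)
      then obtain x where x: "x \<in> X" "y = f x" unfolding Y_def by blast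
      have "F \<subseteq> A' - {x}" using F(2) x(1) by (auto simp: X_def)
      then have "card F \<le> card (moves E F \<inter> (B' - {f x}))" by (rule hallD[OF fhall[OF x(1)] F(1)])
      moreover have "moves E F \<inter> (B' - Y) = moves E F \<inter> (B' - {f x})" using y x(2) by blast
      ultimately show ?thesis by simp
    next
      case 3
      then have "card (moves E F \<inter> Y) * 2 ^ (n + 2) \<le> card F" using few[OF F(1,3)] by linarith
      moreover have "2 * 2 ^ (n + 2) \<le> card (moves E F \<inter> Y) * 2 ^ (n + 2)"
        using 3 by (rule mult_right_mono) simp
      ultimately have "2 * 2 ^ (n + 2) \<le> card F" by (rule order_trans[rotated])
      moreover have "Suc n \<le> 2 ^ (n + 2)" using less_exp[of "n + 2"] by linarith
      then have "2 * Suc n \<le> 2 * 2 ^ (n + 2)" by (rule mult_le_mono2)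
      ultimately have big: "2 * Suc n \<le> card F" by (rule order_trans[rotated])
      have "real (card (moves E F \<inter> (B - (B' - Y)))) \<le> Suc n + card F * (1 - 1 / 2 ^ Suc n) / 2"
        by (rule removed'[OF F(1,3)])
      also have "\<dots> \<le> Suc n + card F / 2"
      proof -
        have "1 - 1 / 2 ^ Suc n \<le> (1 :: real)" by simp
        then have "real (card F) * (1 - 1 / 2 ^ Suc n) \<le> real (card F) * 1"
          by (rule mult_left_mono) simp
        then have "real (card F) * (1 - 1 / 2 ^ Suc n) / 2 \<le> real (card F) / 2"
          unfolding mult_1_right by (rule divide_right_mono) simp
        then show ?thesis by (rule add_left_mono)
      qed
      also have "\<dots> \<le> card F" using big by simp
      finally have "card (moves E F \<inter> (B - (B' - Y))) \<le> card F" by simp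
      moreover have "2 * card F \<le> card (moves E F \<inter> B)" by (rule exp[OF F(1) FA])
      moreover have "card (moves E F \<inter> B) \<le>
          card ((moves E F \<inter> (B' - Y)) \<union> (moves E F \<inter> (B - (B' - Y))))"
        using fin[OF F(1)] by (intro card_mono) auto
      moreover have "\<dots> \<le> card (moves E F \<inter> (B' - Y)) + card (moves E F \<inter> (B - (B' - Y)))"
        by (rule card_Un_le)
      ultimately show ?thesis by linarith
    qed
  qed
  then have "matching_state B (Suc n) (A' - S) (B' - Y)"
    unfolding matching_state_def using removed' A' B' S(1) Y B'B by (auto intro!: sets.Diff)
  then show ?thesis using pm unfolding X_def Y_def by blast
qed

text \<open>
  The stages are iterated along the spread-out sets \<open>S n\<close>. Points matched at different stages have
  different partners, as every stage deletes its partners from \<open>B\<close>.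
\<close>

lemma generic_partial_matching:
  assumes A: "A \<in> sets baire_algebra" and B: "B \<in> sets baire_algebra"
    and exp: "\<And>F. finite F \<Longrightarrow> F \<subseteq> A \<Longrightarrow> 2 * card F \<le> card (moves E F \<inter> B)"
  shows "\<exists>D f. meager (- D) \<and> piecewise_injection E baire_algebra (A \<inter> D) B f"
proof -
  obtain S :: "nat \<Rightarrow> 'x set" where S: "\<And>n. S n \<in> sets borel" "\<And>n. spread_out E (2 ^ (n + 4)) (S n)"
    and comeager: "meager (- (\<Union>n. S n))"
    using generic_spread_out_sets[of E "\<lambda>n. 2 ^ (n + 4)", OF finite_E borel_E] by auto
  have S': "S n \<in> sets baire_algebra" for n using S(1) borel_subset_baire_algebra by blast
  \<comment> \<open>A state consists of the unmatched points, the unused points, and the matching chosen at the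
    preceding stage, which is arbitrary for the initial state.\<close>
  define P where "P n s \<longleftrightarrow> matching_state B n (fst s) (fst (snd s)) \<and> fst s = A - (\<Union>i<n. S i)"
    for n and s :: "'x set \<times> 'x set \<times> ('x \<Rightarrow> 'x)"
  define Q where "Q n s t \<longleftrightarrow>
      piecewise_injection E baire_algebra (S n \<inter> fst s) (fst (snd s)) (snd (snd t)) \<and>
      fst (snd t) = fst (snd s) - snd (snd t) ` (S n \<inter> fst s)"
    for n and s t :: "'x set \<times> 'x set \<times> ('x \<Rightarrow> 'x)"
  have "\<exists>s. \<forall>n. P n (s n) \<and> Q n (s n) (s (Suc n))"
  proof (rule dependent_nat_choice)
    have "hall E A B" by (rule hall_if_expanding[OF exp])
    then have "P 0 (A, B, id)" using A B by (simp add: P_def matching_state_def)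
    then show "\<exists>s. P 0 s" by blast
  next
    fix s n assume P: "P n s"
    have "fst s \<subseteq> A" using P by (auto simp: P_def)
    then have "\<exists>f. piecewise_injection E baire_algebra (S n \<inter> fst s) (fst (snd s)) f \<and>
        matching_state B (Suc n) (fst s - S n) (fst (snd s) - f ` (S n \<inter> fst s))"
      using P exp S(2) S' by (intro matching_step) (auto simp: P_def)
    then obtain f where f: "piecewise_injection E baire_algebra (S n \<inter> fst s) (fst (snd s)) f"
      "matching_state B (Suc n) (fst s - S n) (fst (snd s) - f ` (S n \<inter> fst s))" by (elim exE conjE)
    have "fst s - S n = A - (\<Union>i<Suc n. S i)"
      using P by (auto simp: P_def lessThan_Suc)
    then have "P (Suc n) (fst s - S n, fst (snd s) - f ` (S n \<inter> fst s), f) \<and>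
        Q n s (fst s - S n, fst (snd s) - f ` (S n \<inter> fst s), f)"
      using f by (simp add: P_def Q_def)
    then show "\<exists>t. P (Suc n) t \<and> Q n s t" by blast
  qed
  then obtain s where s: "\<And>n. P n (s n)" "\<And>n. Q n (s n) (s (Suc n))" by blast
  define X where "X n = S n \<inter> (A - (\<Union>i<n. S i))" for n
  define R where "R n = fst (snd (s n))" for n
  define f where "f n = snd (snd (s (Suc n)))" for n
  have pm: "piecewise_injection E baire_algebra (X n) (R n) (f n)" and R_Suc: "R (Suc n) = R n - f n ` X n" for n
    using s(1)[of n] s(2)[of n] by (simp_all add: P_def Q_def X_def R_def f_def)
  have RB: "R n \<subseteq> B" for n using s(1)[of n] by (simp add: P_def R_def matching_state_def)
  have R_mono: "R n \<subseteq> R m" if "m \<le> n" for m n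
    using that by (induction n rule: dec_induct) (auto simp: R_Suc)
  have X_disj: "m = n" if x: "x \<in> X m" "x \<in> X n" for x m n
    using x unfolding X_def by (metis DiffD2 IntD1 IntD2 UN_I lessThan_iff linorder_neqE_nat)
  have X_Un: "A \<inter> (\<Union>n. S n) = (\<Union>n. X n)"
  proof (intro equalityI subsetI)
    fix x assume x: "x \<in> A \<inter> (\<Union>n. S n)"
    then have "\<exists>n. x \<in> S n" by blast
    define n where "n = (LEAST n. x \<in> S n)"
    have "x \<in> S n" unfolding n_def by (rule LeastI_ex) (rule \<open>\<exists>n. x \<in> S n\<close>)
    moreover have "x \<notin> S i" if "i < n" for i using not_less_Least that unfolding n_def by blast
    ultimately have "x \<in> X n" using x unfolding X_def by blast
    then show "x \<in> (\<Union>n. X n)" by blast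
  qed (auto simp: X_def)
  define g where "g x = f (THE n. x \<in> X n) x" for x
  have g: "g x = f n x" if x: "x \<in> X n" for x n
  proof -
    have "(THE n. x \<in> X n) = n" by (rule the_equality) (rule x, rule X_disj[OF _ x])
    then show ?thesis by (simp add: g_def)
  qed
  have fR: "f n x \<in> R n" "\<exists>e\<in>E. f n x = e x" if "x \<in> X n" for n x
    using pm[of n] that unfolding piecewise_injection_def by auto
  have f_neq: "f m x \<noteq> f n y" if mn: "m < n" and x: "x \<in> X m" and y: "y \<in> X n" for m n x y
  proof -
    have "f n y \<in> R (Suc m)" using R_mono[of "Suc m" n] fR(1)[OF y] mn by auto
    then show ?thesis unfolding R_Suc using x by (metis DiffD2 imageI)
  qed
  have "piecewise_injection E baire_algebra (A \<inter> (\<Union>n. S n)) B g"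
    unfolding piecewise_injection_def X_Un
  proof (intro conjI ballI)
    show "inj_on g (\<Union>n. X n)"
    proof (rule inj_onI)
      fix x y assume "x \<in> (\<Union>n. X n)" "y \<in> (\<Union>n. X n)" and eq: "g x = g y"
      then obtain m n where x: "x \<in> X m" and y: "y \<in> X n" by blast
      have eq': "f m x = f n y" using eq g[OF x] g[OF y] by simp
      have "m = n" using f_neq[OF _ x y] f_neq[OF _ y x] eq' by (metis linorder_neqE_nat)
      then show "x = y"
        using pm[of m] x y eq' unfolding piecewise_injection_def by (auto dest: inj_onD)
    qed
  next
    fix x assume "x \<in> (\<Union>n. X n)"
    then obtain n where x: "x \<in> X n" by blast
    show "g x \<in> B" using fR(1)[OF x] RB[of n] g[OF x] by auto
    show "\<exists>e\<in>E. g x = e x" using fR(2)[OF x] g[OF x] by simp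
  next
    fix e assume e: "e \<in> E"
    have "{x \<in> X n. f n x = e x} \<in> sets baire_algebra" for n
      using pm[of n] e unfolding piecewise_injection_def by simp
    then have "(\<Union>n. {x \<in> X n. f n x = e x}) \<in> sets baire_algebra" by (intro sets.countable_UN) auto
    moreover have "(\<Union>n. {x \<in> X n. f n x = e x}) = {x \<in> (\<Union>n. X n). g x = e x}"
      using g by auto
    ultimately show "{x \<in> (\<Union>n. X n). g x = e x} \<in> sets baire_algebra" by simp
  qed
  then show ?thesis using comeager by blast
qed

text \<open>
  \<open>N\<close> is the union of the preimages of \<open>M\<close> under all words.
\<close>

lemma invariant_meager_hull:
  assumes "meager M"
  shows "\<exists>N. meager N \<and> M \<subseteq> N \<and> (\<forall>e\<in>E. \<forall>x. e x \<in> N \<longleftrightarrow> x \<in> N)"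
proof (intro exI conjI ballI allI iffI)
  let ?N = "\<Union>n. \<Union>u\<in>words E n. u -` M"
  show "meager ?N"
    by (intro meager_UN_nat meager_UN countable_finite finite_words finite_E meager_words[OF _ assms])
  show "M \<subseteq> ?N"
  proof
    fix x assume "x \<in> M"
    then show "x \<in> ?N" by (intro UN_I[of 0] UN_I[of id]) auto
  qed
  fix e x assume e: "e \<in> E"
  {
    assume "e x \<in> ?N"
    then obtain n u where u: "u \<in> words E n" "u (e x) \<in> M" by auto
    have "e \<in> words E 1" using e unfolding words_1 .
    then have "u \<circ> e \<in> words E (n + 1)" using u(1) by (rule words_comp)
    moreover have "(u \<circ> e) x \<in> M" using u(2) by simp
    ultimately show "x \<in> ?N" by blast
  }
  {
    assume "x \<in> ?N"
    then obtain n u where u: "u \<in> words E n" "u x \<in> M" by auto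
    obtain e' where e': "e' \<in> E" "e' \<circ> e = id" using inverse_E[OF e] by blast
    have "e' \<in> words E 1" using e' unfolding words_1 by simp
    then have "u \<circ> e' \<in> words E (n + 1)" using u(1) by (rule words_comp)
    moreover have "(u \<circ> e') (e x) \<in> M" using u(2) fun_cong[OF e'(2), of x] by simp
    ultimately show "e x \<in> ?N" by blast
  }
qed

text \<open>
  The generic matching is corrected on an invariant meager set, which contains all unmatched points.
  Invariance ensures that the two matchings do not interfere, since both move points along \<open>E\<close>.
\<close>

theorem baire_matching:
  assumes A: "A \<in> sets baire_algebra" and B: "B \<in> sets baire_algebra"
    and exp: "\<And>F. finite F \<Longrightarrow> F \<subseteq> A \<Longrightarrow> 2 * card F \<le> card (moves E F \<inter> B)"
  shows "\<exists>f. piecewise_injection E baire_algebra A B f"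
proof -
  obtain D g where D: "meager (- D)" and pg: "piecewise_injection E baire_algebra (A \<inter> D) B g"
    using generic_partial_matching[OF A B exp] by blast
  obtain N where N: "meager N" "- D \<subseteq> N" and inv: "\<And>e x. e \<in> E \<Longrightarrow> e x \<in> N \<longleftrightarrow> x \<in> N"
    using invariant_meager_hull[OF D] by (elim exE conjE) simp
  have "hall E A B" by (rule hall_if_expanding[OF exp])
  then obtain h where h: "inj_on h A" "\<forall>x\<in>A. h x \<in> B \<and> (\<exists>e\<in>E. h x = e x)"
    unfolding hall_iff_injection[OF finite_E] by (elim exE conjE)
  have g: "inj_on g (A \<inter> D)" "\<forall>x\<in>A \<inter> D. g x \<in> B \<and> (\<exists>e\<in>E. g x = e x)"
    "\<And>e. e \<in> E \<Longrightarrow> {x \<in> A \<inter> D. g x = e x} \<in> sets baire_algebra"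
    using pg unfolding piecewise_injection_def by auto
  define f where "f x = (if x \<in> N then h x else g x)" for x
  have f_mem: "f x \<in> B \<and> (\<exists>e\<in>E. f x = e x)" if "x \<in> A" for x
    using h(2) g(2) N(2) that by (auto simp: f_def)
  have f_inv: "f x \<in> N \<longleftrightarrow> x \<in> N" if "x \<in> A" for x
    using f_mem[OF that] inv by auto
  have "inj_on f A"
  proof (rule inj_onI)
    fix x y assume x: "x \<in> A" and y: "y \<in> A" and eq: "f x = f y"
    have iff: "x \<in> N \<longleftrightarrow> y \<in> N" using f_inv[OF x] f_inv[OF y] eq by simp
    show "x = y"
    proof (cases "x \<in> N")
      case True
      then show ?thesis using eq iff inj_onD[OF h(1) _ x y] by (simp add: f_def)
    next
      case False
      then have "x \<in> A \<inter> D" "y \<in> A \<inter> D" using x y iff N(2) by auto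
      then show ?thesis using eq False iff inj_onD[OF g(1), of x y] by (simp add: f_def)
    qed
  qed
  moreover have "{x \<in> A. f x = e x} \<in> sets baire_algebra" if e: "e \<in> E" for e
  proof -
    have meager_sets: "M \<in> sets baire_algebra" if "M \<subseteq> N" for M
      unfolding sets_baire_algebra by (rule baire_property_meager[OF meager_mono[OF N(1) that]])
    have "{x \<in> A. f x = e x} = {x \<in> A \<inter> N. h x = e x} \<union> ({x \<in> A \<inter> D. g x = e x} - N)"
      using N(2) by (auto simp: f_def)
    moreover have "{x \<in> A \<inter> N. h x = e x} \<in> sets baire_algebra" by (rule meager_sets) blast
    moreover have "{x \<in> A \<inter> D. g x = e x} - N \<in> sets baire_algebra"
      by (rule sets.Diff[OF g(3)[OF e] meager_sets]) simp
    ultimately show ?thesis by simp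
  qed
  ultimately have "piecewise_injection E baire_algebra A B f"
    unfolding piecewise_injection_def using f_mem by auto
  then show ?thesis by blast
qed

end

section \<open>Equidecomposability and piecewise bijections\<close>

lemma image_piecewise_injection:
  assumes "finite E" and img: "\<And>e Y. e \<in> E \<Longrightarrow> Y \<in> sets M \<Longrightarrow> e ` Y \<in> sets M"
    and f: "piecewise_injection E M A B f" and Y: "Y \<in> sets M" "Y \<subseteq> A"
  shows "f ` Y \<in> sets M"
proof -
  have "(\<Union>e\<in>E. e ` ({x \<in> A. f x = e x} \<inter> Y)) \<in> sets M"
    using f Y(1) by (intro sets.finite_UN[OF assms(1)] img sets.Int) (auto simp: piecewise_injection_def)
  moreover have "(\<Union>e\<in>E. e ` ({x \<in> A. f x = e x} \<inter> Y)) = f ` Y"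
  proof (intro equalityI subsetI)
    fix y assume "y \<in> f ` Y"
    then obtain x where x: "x \<in> Y" "y = f x" by blast
    then obtain e where e: "e \<in> E" "f x = e x"
      using f Y(2) unfolding piecewise_injection_def by blast
    have "y \<in> e ` ({x \<in> A. f x = e x} \<inter> Y)"
      using x e Y(2) by (intro image_eqI[of _ _ x]) auto
    then show "y \<in> (\<Union>e\<in>E. e ` ({x \<in> A. f x = e x} \<inter> Y))" using e(1) by blast
  next
    fix y assume "y \<in> (\<Union>e\<in>E. e ` ({x \<in> A. f x = e x} \<inter> Y))"
    then obtain e x where "x \<in> Y" "f x = e x" "y = e x" by blast
    then show "y \<in> f ` Y" by (metis imageI)
  qed
  ultimately show ?thesis by simp
qed

text \<open>
  The classical proof, in which \<open>h\<close> is \<open>f\<close> on the union \<open>U\<close> of the sets \<open>(g \<circ> f)\<^sup>n (A - g B)\<close> and the inverse of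
  \<open>g\<close> elsewhere. Unlike the least fixed point used in order-theoretic proofs, this union is visibly in
  the \<open>\<sigma>\<close>-algebra.
\<close>

theorem (in symmetric_maps) piecewise_Schroeder_Bernstein:
  assumes img: "\<And>e Y. e \<in> E \<Longrightarrow> Y \<in> sets M \<Longrightarrow> e ` Y \<in> sets M"
    and A: "A \<in> sets M" and B: "B \<in> sets M"
    and f: "piecewise_injection E M A B f" and g: "piecewise_injection E M B A g"
  shows "\<exists>h. piecewise_injection E M A B h \<and> h ` A = B"
proof -
  have f_inj: "inj_on f A" and fB: "\<And>x. x \<in> A \<Longrightarrow> f x \<in> B" and fE: "\<And>x. x \<in> A \<Longrightarrow> \<exists>e\<in>E. f x = e x"
    and f_sets: "\<And>e. e \<in> E \<Longrightarrow> {x \<in> A. f x = e x} \<in> sets M"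
    using f by (auto simp: piecewise_injection_def)
  have g_inj: "inj_on g B" and gA: "\<And>x. x \<in> B \<Longrightarrow> g x \<in> A" and gE: "\<And>x. x \<in> B \<Longrightarrow> \<exists>e\<in>E. g x = e x"
    and g_sets: "\<And>e. e \<in> E \<Longrightarrow> {x \<in> B. g x = e x} \<in> sets M"
    using g by (auto simp: piecewise_injection_def)
  define D where "D n = ((\<lambda>X. g ` f ` X) ^^ n) (A - g ` B)" for n
  have D_Suc: "D (Suc n) = g ` f ` D n" for n by (simp add: D_def)
  have DA: "D n \<subseteq> A" for n
  proof (induction n)
    case (Suc n)
    then show ?case unfolding D_Suc using fB gA by blast
  qed (auto simp: D_def)
  have D_sets: "D n \<in> sets M" for n
  proof (induction n)
    case 0
    have "g ` B \<in> sets M" by (rule image_piecewise_injection[OF finite_E img g B]) auto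
    then show ?case using A by (simp add: D_def sets.Diff)
  next
    case (Suc n)
    have 1: "f ` D n \<in> sets M" by (rule image_piecewise_injection[OF finite_E img f Suc DA])
    have 2: "f ` D n \<subseteq> B" using fB DA by blast
    show ?case unfolding D_Suc by (rule image_piecewise_injection[OF finite_E img g 1 2])
  qed
  define U where "U = (\<Union>n. D n)"
  have U_sets: "U \<in> sets M" unfolding U_def using D_sets by (intro sets.countable_UN) auto
  have UA: "U \<subseteq> A" using DA by (auto simp: U_def)
  have gfU: "g (f x) \<in> U" if x: "x \<in> U" for x
  proof -
    obtain n where "x \<in> D n" using x by (auto simp: U_def)
    then have "g (f x) \<in> D (Suc n)" unfolding D_Suc by blast
    then show ?thesis by (auto simp: U_def)
  qed
  have outside: "x \<in> g ` B" if "x \<in> A" "x \<notin> U" for x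
  proof (rule ccontr)
    assume "x \<notin> g ` B"
    then have "x \<in> D 0" using that by (simp add: D_def)
    then show False using that by (auto simp: U_def)
  qed
  define k where "k = inv_into B g"
  have kB: "k x \<in> B" and gk: "g (k x) = x" if "x \<in> A" "x \<notin> U" for x
    using inv_into_into[OF outside[OF that]] f_inv_into_f[OF outside[OF that]] by (simp_all add: k_def)
  have kg: "k (g y) = y" if "y \<in> B" for y unfolding k_def by (rule inv_into_f_f[OF g_inj that])
  define h where "h x = (if x \<in> U then f x else k x)" for x
  have h_inj: "inj_on h A"
  proof (rule inj_onI)
    have mixed: False if x: "x \<in> U" and y: "y \<in> A" "y \<notin> U" and eq: "f x = k y" for x y
      using gfU[OF x] y gk[OF y] eq by simp
    fix x y assume x: "x \<in> A" and y: "y \<in> A" and eq: "h x = h y"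
    consider "x \<in> U" "y \<in> U" | "x \<in> U" "y \<notin> U" | "x \<notin> U" "y \<in> U" | "x \<notin> U" "y \<notin> U" by blast
    then show "x = y"
    proof cases
      case 1
      then show ?thesis using eq inj_onD[OF f_inj _ x y] by (simp add: h_def)
    next
      case 2
      then show ?thesis using mixed[of x y] y eq by (simp add: h_def)
    next
      case 3
      then show ?thesis using mixed[of y x] x eq by (simp add: h_def)
    next
      case 4
      then have "g (k x) = g (k y)" using eq by (simp add: h_def)
      then show ?thesis using gk[OF x 4(1)] gk[OF y 4(2)] by simp
    qed
  qed
  have "h ` A = B"
  proof (intro equalityI subsetI)
    fix y assume "y \<in> h ` A"
    then show "y \<in> B" using fB kB by (auto simp: h_def)
  next
    fix y assume y: "y \<in> B"
    show "y \<in> h ` A"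
    proof (cases "g y \<in> U")
      case True
      then obtain n where n: "g y \<in> D n" by (auto simp: U_def)
      have "n \<noteq> 0" using n y by (cases n) (auto simp: D_def)
      then obtain m where m: "n = Suc m" by (cases n) auto
      have "g y \<in> g ` f ` D m" using n unfolding m D_Suc .
      then obtain z where z: "z \<in> D m" "g y = g (f z)" by blast
      have zA: "z \<in> A" using z(1) DA by blast
      have "y = f z" by (rule inj_onD[OF g_inj z(2) y fB[OF zA]])
      moreover have "z \<in> U" using z(1) by (auto simp: U_def)
      ultimately have "y = h z" by (simp add: h_def)
      then show ?thesis using zA by blast
    next
      case False
      then have "h (g y) = y" using kg[OF y] by (simp add: h_def)
      then show ?thesis using gA[OF y] by (metis imageI)
    qed
  qed
  moreover have "piecewise_injection E M A B h"
    unfolding piecewise_injection_def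
  proof (intro conjI ballI h_inj)
    fix x assume x: "x \<in> A"
    show "h x \<in> B" using fB[OF x] kB[OF x] by (simp add: h_def)
    show "\<exists>e\<in>E. h x = e x"
    proof (cases "x \<in> U")
      case True
      then show ?thesis using fE[OF x] by (simp add: h_def)
    next
      case False
      obtain e where e: "e \<in> E" "g (k x) = e (k x)" using gE[OF kB[OF x False]] by blast
      obtain e' where e': "e' \<in> E" "e' \<circ> e = id" using inverse_E[OF e(1)] by blast
      have "h x = e' x" using fun_cong[OF e'(2), of "k x"] e(2) gk[OF x False] False
        by (simp add: h_def)
      then show ?thesis using e'(1) by blast
    qed
  next
    fix e assume e: "e \<in> E"
    obtain e' where e': "e' \<in> E" "e' \<circ> e = id" "e \<circ> e' = id" using inverse_E[OF e] by blast
    have inv: "e' (e x) = x" "e (e' x) = x" for x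
      using fun_cong[OF e'(2), of x] fun_cong[OF e'(3), of x] by simp_all
    have "{x \<in> A. h x = e x} = ({x \<in> A. f x = e x} \<inter> U) \<union> ((A - U) \<inter> e' ` {y \<in> B. g y = e' y})"
    proof (intro equalityI subsetI)
      fix x assume x: "x \<in> {x \<in> A. h x = e x}"
      show "x \<in> ({x \<in> A. f x = e x} \<inter> U) \<union> ((A - U) \<inter> e' ` {y \<in> B. g y = e' y})"
      proof (cases "x \<in> U")
        case True
        then show ?thesis using x by (simp add: h_def)
      next
        case False
        then have k: "k x = e x" "x \<in> A" using x by (simp_all add: h_def)
        have "e x \<in> B" "g (e x) = e' (e x)" using kB[OF k(2) False] gk[OF k(2) False] k(1) inv by simp_all
        then have "e' (e x) \<in> e' ` {y \<in> B. g y = e' y}" by blast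
        then show ?thesis using False k(2) inv by simp
      qed
    next
      fix x assume "x \<in> ({x \<in> A. f x = e x} \<inter> U) \<union> ((A - U) \<inter> e' ` {y \<in> B. g y = e' y})"
      then show "x \<in> {x \<in> A. h x = e x}"
      proof
        assume "x \<in> (A - U) \<inter> e' ` {y \<in> B. g y = e' y}"
        then obtain y where y: "x \<in> A" "x \<notin> U" "y \<in> B" "g y = e' y" "x = e' y" by blast
        have "k x = e x" using kg[OF y(3)] y(4,5) inv(2)[of y] by simp
        then show ?thesis using y by (simp add: h_def)
      qed (simp add: h_def)
    qed
    moreover have "e' ` {y \<in> B. g y = e' y} \<in> sets M" by (rule img[OF e'(1) g_sets[OF e'(1)]])
    ultimately show "{x \<in> A. h x = e x} \<in> sets M"
      using f_sets[OF e] U_sets A by (simp add: sets.Int sets.Un sets.Diff)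
  qed
  ultimately show ?thesis by blast
qed

text \<open>
  The pieces are made disjoint by using, at each point, the first group element in an enumeration of
  \<open>W\<close> that agrees with \<open>h\<close> there.
\<close>

lemma equidecomposable_if_piecewise_bijection:
  assumes W: "finite W" "W \<subseteq> carrier G"
    and h: "piecewise_injection (a ` W) M A B h" "h ` A = B"
  shows "equidecomposable G a (sets M) A B"
proof -
  obtain \<gamma> where \<gamma>: "bij_betw \<gamma> {0..<card W} W" using ex_bij_betw_nat_finite[OF W(1)] by blast
  define m where "m = card W"
  have \<gamma>W: "\<gamma> i \<in> W" if "i < m" for i using \<gamma> that unfolding m_def by (auto dest: bij_betwE)
  define Q where "Q i = {x \<in> A. h x = a (\<gamma> i) x}" for i
  define P where "P i = Q i - (\<Union>j<i. Q j)" for i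
  have Q_sets: "Q i \<in> sets M" if "i < m" for i
    using h(1) \<gamma>W[OF that] unfolding piecewise_injection_def Q_def by blast
  have P_sets: "P i \<in> sets M" if "i < m" for i
    unfolding P_def using that by (intro sets.Diff sets.finite_UN Q_sets) auto
  have disj: "i = j" if "x \<in> P i" "x \<in> P j" for x i j
    using that unfolding P_def by (metis DiffD1 DiffD2 UN_I lessThan_iff linorder_neqE_nat)
  have PA: "P i \<subseteq> A" for i by (auto simp: P_def Q_def)
  have UP: "(\<Union>i<m. P i) = A"
  proof (intro equalityI subsetI)
    fix x assume x: "x \<in> A"
    obtain w where w: "w \<in> W" "h x = a w x" using h(1) x unfolding piecewise_injection_def by blast
    obtain i where i: "i < m" "\<gamma> i = w" using \<gamma> w(1) unfolding bij_betw_def m_def by force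
    have ex: "x \<in> Q i" using x w i by (simp add: Q_def)
    define l where "l = (LEAST i. x \<in> Q i)"
    have "x \<in> Q l" unfolding l_def by (rule LeastI[of "\<lambda>i. x \<in> Q i", OF ex])
    moreover have "x \<notin> Q j" if "j < l" for j using not_less_Least[of j "\<lambda>i. x \<in> Q i"] that l_def by simp
    ultimately have "x \<in> P l" by (auto simp: P_def)
    moreover have "l \<le> i" unfolding l_def by (rule Least_le[of "\<lambda>i. x \<in> Q i", OF ex])
    ultimately show "x \<in> (\<Union>i<m. P i)" using i(1) by auto
  qed (use PA in blast)
  have img: "a (\<gamma> i) ` P i = h ` P i" for i
    by (rule image_cong) (auto simp: P_def Q_def)
  have "disjoint_family_on P {..<m}"
    using disj by (auto simp: disjoint_family_on_def)
  moreover have "disjoint_family_on (\<lambda>i. a (\<gamma> i) ` P i) {..<m}"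
    unfolding img disjoint_family_on_def
  proof (intro ballI impI)
    fix i j :: nat assume "i \<noteq> j"
    then have "P i \<inter> P j = {}" using disj by blast
    moreover have "inj_on h A" using h(1) by (simp add: piecewise_injection_def)
    ultimately show "h ` P i \<inter> h ` P j = {}"
      using inj_on_image_Int[of h A "P i" "P j"] PA by simp
  qed
  moreover have "(\<Union>i<m. a (\<gamma> i) ` P i) = B"
    unfolding img image_UN[symmetric] UP by (rule h(2))
  moreover have "\<forall>i<m. \<gamma> i \<in> carrier G \<and> P i \<in> sets M" using \<gamma>W W(2) P_sets by blast
  ultimately show ?thesis
    unfolding equidecomposable_def using UP by (intro exI conjI)
qed

lemma equidecomposable_bijection:
  assumes eq: "equidecomposable G a \<F> A B"
    and inj: "\<And>\<gamma>. \<gamma> \<in> carrier G \<Longrightarrow> inj (a \<gamma>)"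
  shows "\<exists>h W. finite W \<and> W \<subseteq> carrier G \<and> bij_betw h A B \<and> (\<forall>x\<in>A. \<exists>w\<in>W. h x = a w x)"
proof -
  obtain m \<gamma> P where G\<F>: "\<forall>i<(m::nat). \<gamma> i \<in> carrier G \<and> P i \<in> \<F>"
    and dP: "disjoint_family_on P {..<m}" and UP: "(\<Union>i<m. P i) = A"
    and daP: "disjoint_family_on (\<lambda>i. a (\<gamma> i) ` P i) {..<m}" and UaP: "(\<Union>i<m. a (\<gamma> i) ` P i) = B"
    using eq unfolding equidecomposable_def by - (elim exE conjE, rule that)
  have \<gamma>: "\<gamma> i \<in> carrier G" if "i < m" for i using G\<F> that by blast
  define idx where "idx x = (THE i. i < m \<and> x \<in> P i)" for x
  have idx: "idx x = i" if "i < m" "x \<in> P i" for x i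
    unfolding idx_def
  proof (rule the_equality)
    fix j assume "j < m \<and> x \<in> P j"
    then show "j = i" using dP that unfolding disjoint_family_on_def by blast
  qed (use that in blast)
  define h where "h x = a (\<gamma> (idx x)) x" for x
  have h: "h x = a (\<gamma> i) x" if "i < m" "x \<in> P i" for x i
    using idx[OF that] by (simp add: h_def)
  have "inj_on h A"
  proof (rule inj_onI)
    fix x y assume "x \<in> A" "y \<in> A" and eq: "h x = h y"
    then obtain i j where i: "i < m" "x \<in> P i" and j: "j < m" "y \<in> P j" using UP by blast
    have "a (\<gamma> i) x = a (\<gamma> j) y" using eq h[OF i] h[OF j] by simp
    then have "a (\<gamma> i) ` P i \<inter> a (\<gamma> j) ` P j \<noteq> {}" using i(2) j(2) by blast
    then have "i = j" using daP i(1) j(1) unfolding disjoint_family_on_def by blast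
    then show "x = y" using eq h[OF i] h[OF j] injD[OF inj[OF \<gamma>[OF i(1)]]] by simp
  qed
  moreover have "h ` A = B"
  proof -
    have "h ` A = (\<Union>i<m. h ` P i)" unfolding UP[symmetric] by blast
    also have "\<dots> = (\<Union>i<m. a (\<gamma> i) ` P i)" using h by (intro SUP_cong image_cong) auto
    finally show ?thesis using UaP by simp
  qed
  ultimately have "bij_betw h A B" by (simp add: bij_betw_def)
  moreover have "\<forall>x\<in>A. \<exists>w\<in>\<gamma> ` {..<m}. h x = a w x"
    using UP h by (metis UN_E imageI lessThan_iff)
  ultimately show ?thesis using \<gamma> by (intro exI[of _ h] exI[of _ "\<gamma> ` {..<m}"]) auto
qed

section \<open>Separation and local compactness\<close>

lemma disjoint_open_subsets:
  fixes V :: "'x::t2_space set"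
  assumes no_isolated: "\<And>x::'x. \<not> open {x}" and V: "open V" "V \<noteq> {}"
  shows "\<exists>D. (\<forall>j<k. open (D j) \<and> D j \<noteq> {} \<and> D j \<subseteq> V) \<and> disjoint_family_on D {..<(k::nat)}"
  using V
proof (induction k arbitrary: V)
  case 0
  then show ?case by (simp add: disjoint_family_on_def)
next
  case (Suc k)
  obtain x where x: "x \<in> V" using Suc.prems by blast
  have "V \<noteq> {x}" using Suc.prems no_isolated by auto
  then obtain y where y: "y \<in> V" "x \<noteq> y" using x by blast
  obtain S T where ST: "open S" "open T" "x \<in> S" "y \<in> T" "S \<inter> T = {}"
    using hausdorff[OF y(2)] by blast
  obtain D where D: "\<And>j. j < k \<Longrightarrow> open (D j) \<and> D j \<noteq> {} \<and> D j \<subseteq> T \<inter> V"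
    and dis: "disjoint_family_on D {..<k}"
    using Suc.IH[of "T \<inter> V"] ST Suc.prems y by auto
  define D' where "D' j = (if j < k then D j else S \<inter> V)" for j
  have "open (D' j) \<and> D' j \<noteq> {} \<and> D' j \<subseteq> V" for j
    using D[of j] ST(1,3) Suc.prems(1) x by (auto simp: D'_def)
  moreover have "disjoint_family_on D' {..<Suc k}"
    unfolding disjoint_family_on_def
  proof (intro ballI impI)
    fix i j assume ij: "i \<in> {..<Suc k}" "j \<in> {..<Suc k}" "i \<noteq> j"
    then consider "i < k" "j < k" | "i < k" "j = k" | "i = k" "j < k" by fastforce
    then show "D' i \<inter> D' j = {}"
    proof cases
      case 1
      then show ?thesis using dis ij(3) by (simp add: D'_def disjoint_family_on_def)
    next
      case 2
      then show ?thesis using D[of i] ST(5) by (auto simp: D'_def)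
    next
      case 3
      then show ?thesis using D[of j] ST(5) by (auto simp: D'_def)
    qed
  qed
  ultimately show ?case by blast
qed

lemma compact_closure_if_subset_compact:
  fixes S :: "'x::t2_space set"
  assumes "compact C" "S \<subseteq> C"
  shows "compact (closure S)"
proof -
  have "closure S \<subseteq> C" using assms by (intro closure_minimal compact_imp_closed)
  then show ?thesis using compact_Int_closed[OF assms(1) closed_closure[of S]] by (simp add: Int_absorb1)
qed

lemma locally_compact_open_subset:
  fixes U :: "'x::t2_space set"
  assumes "locally compact (UNIV :: 'x set)" "open U" "U \<noteq> {}"
  shows "\<exists>V. open V \<and> V \<noteq> {} \<and> V \<subseteq> U \<and> compact (closure V)"
proof -
  obtain x where x: "x \<in> U" using assms(3) by blast
  have "openin (top_of_set UNIV) U" using assms(2) by simp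
  then obtain V C where V: "openin (top_of_set UNIV) V" "compact C" "x \<in> V" "V \<subseteq> C" "C \<subseteq> U"
    using locallyE[OF assms(1) _ x] by metis
  have "compact (closure V)" by (rule compact_closure_if_subset_compact[OF V(2,4)])
  moreover have "open V" using V(1) by simp
  ultimately show ?thesis using V(3-5) by blast
qed

section \<open>Paradoxical actions\<close>

lemma covering_familyE:
  assumes "A \<in> covering_family G a"
  obtains U T where "compact (closure A)" "open U" "U \<noteq> {}" "finite T" "T \<subseteq> carrier G"
    "U \<subseteq> translates a T A"
  using assms unfolding covering_family_def covers_def by blast

context
  fixes G :: "('g, 'm) monoid_scheme" and a :: "'g \<Rightarrow> 'x::polish_space \<Rightarrow> 'x"
  assumes paradoxical: "paradoxical_action G a"
begin

lemma paradoxical_group_action: "group_action G UNIV a"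
  using paradoxical by (simp add: paradoxical_action_def borel_action_def)

lemma paradoxical_group: "group G"
  using paradoxical_group_action by (simp add: group_action_def group_hom_def)

lemma action_mult: "g \<in> carrier G \<Longrightarrow> h \<in> carrier G \<Longrightarrow> a (g \<otimes>\<^bsub>G\<^esub> h) x = a g (a h x)"
  by (rule group_action.composition_rule[OF paradoxical_group_action]) simp_all

lemma action_inv: "g \<in> carrier G \<Longrightarrow> a (inv\<^bsub>G\<^esub> g) (a g x) = x"
  by (rule group_action.orbit_sym_aux[OF paradoxical_group_action]) simp_all

lemma action_inv': "g \<in> carrier G \<Longrightarrow> a g (a (inv\<^bsub>G\<^esub> g) x) = x"
  using action_inv[of "inv\<^bsub>G\<^esub> g" x] group.inv_inv[OF paradoxical_group, of g]
    group.inv_closed[OF paradoxical_group, of g] by simp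

lemma action_one: "a \<one>\<^bsub>G\<^esub> = id"
  using group_action.id_eq_one[OF paradoxical_group_action] by (auto simp: fun_eq_iff)

lemma action_inj: "g \<in> carrier G \<Longrightarrow> inj (a g)"
  by (rule inj_on_inverseI[of _ "a (inv\<^bsub>G\<^esub> g)"]) (rule action_inv)

lemma action_bij: "g \<in> carrier G \<Longrightarrow> bij (a g)"
  by (rule o_bij[of "a (inv\<^bsub>G\<^esub> g)"]) (simp_all add: fun_eq_iff action_inv action_inv')

lemma action_vimage: "g \<in> carrier G \<Longrightarrow> a g -` S = a (inv\<^bsub>G\<^esub> g) ` S"
proof (intro equalityI subsetI)
  fix x assume g: "g \<in> carrier G" and "x \<in> a g -` S"
  then have "a (inv\<^bsub>G\<^esub> g) (a g x) \<in> a (inv\<^bsub>G\<^esub> g) ` S" by blast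
  then show "x \<in> a (inv\<^bsub>G\<^esub> g) ` S" unfolding action_inv[OF g] .
qed (auto simp: action_inv')

lemma action_equidecomposable_bijection:
  assumes "equidecomposable G a \<F> A B"
  shows "\<exists>h W. finite W \<and> W \<subseteq> carrier G \<and> bij_betw h A B \<and> (\<forall>x\<in>A. \<exists>w\<in>W. h x = a w x)"
  by (rule equidecomposable_bijection[OF assms]) (rule action_inj)

text \<open>
  If \<open>{x}\<close> were open, then \<open>{x}\<close> and \<open>{x, y}\<close> would be equidecomposable.
\<close>

lemma not_open_singleton:
  assumes "(x::'x) \<noteq> y"
  shows "\<not> open {x}"
proof
  assume o: "open {x}"
  then have "interior {x} \<noteq> {}" "interior {x, y} \<noteq> {}"
    using interior_maximal[of "{x}" "{x, y}"] by (auto simp: interior_open)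
  moreover have "compact (closure {x})" "compact (closure {x, y})"
    by (simp_all add: closure_closed finite_imp_closed finite_imp_compact)
  ultimately have "equidecomposable G a UNIV {x} {x, y}"
    using paradoxical unfolding paradoxical_action_def by blast
  then obtain h where "bij_betw h {x} {x, y}"
    using action_equidecomposable_bijection by blast
  then have "card {x} = card {x, y}" by (rule bij_betw_same_card)
  then show False using assms by simp
qed

text \<open>
  \<open>B\<close> covers an open set \<open>V\<close> by \<open>n\<close> translates. The maps \<open>h j\<close> put \<open>2 n\<close> disjoint copies of \<open>A\<close> into \<open>V\<close>, and \<open>b\<close>
  sends the points of \<open>V\<close> into \<open>B\<close>, at most \<open>n\<close> of them to the same point. So the image \<open>Q\<close> of \<open>F\<close> in \<open>V\<close> has
  \<open>2 n |F|\<close> points and yields at least \<open>2 |F|\<close> points of \<open>B\<close>.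
\<close>

lemma covering_family_expansion:
  assumes two: "(x0::'x) \<noteq> y0"
    and A: "A \<in> covering_family G a" and B: "B \<in> covering_family G a"
  shows "\<exists>W. finite W \<and> W \<subseteq> carrier G \<and>
    (\<forall>F. finite F \<and> F \<subseteq> A \<longrightarrow> 2 * card F \<le> card (moves (a ` W) F \<inter> B))"
proof -
  obtain U T where U: "open U" "U \<noteq> {}" and T: "finite T" "T \<subseteq> carrier G"
    and UT: "U \<subseteq> translates a T B" using B by (rule covering_familyE)
  obtain V where V: "open V" "V \<noteq> {}" "V \<subseteq> U" "compact (closure V)"
    using locally_compact_open_subset[OF _ U] paradoxical unfolding paradoxical_action_def by blast
  define n where "n = card T"
  have "T \<noteq> {}" using UT V(2,3) by (auto simp: translates_def)
  then have n: "n > 0" using T(1) by (simp add: n_def card_gt_0_iff)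
  have no_isolated: "\<not> open {x}" for x :: 'x
    using not_open_singleton[of x x0] not_open_singleton[of x y0] two by metis
  obtain D where D: "\<And>j. j < 2 * n \<Longrightarrow> open (D j) \<and> D j \<noteq> {} \<and> D j \<subseteq> V"
    and disD: "disjoint_family_on D {..<2 * n}"
    using disjoint_open_subsets[OF no_isolated V(1,2), of "2 * n"] by auto
  \<comment> \<open>The set \<open>A\<close> may have empty interior, so \<open>V\<close> is added to it before paradoxicality is applied.\<close>
  define X where "X = A \<union> V"
  have "compact (closure A)" using A by (simp add: covering_family_def)
  then have X: "compact (closure X)" "interior X \<noteq> {}"
    using V interior_maximal[of V X] by (auto simp: X_def compact_Un)
  define K where "K j h W \<longleftrightarrow> finite W \<and> W \<subseteq> carrier G \<and> bij_betw h X (D j) \<and>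
      (\<forall>x\<in>X. \<exists>w\<in>W. h x = a w x)" for j h W
  have "\<exists>h W. K j h W" if j: "j < 2 * n" for j
    unfolding K_def
  proof (rule action_equidecomposable_bijection)
    have "D j \<subseteq> closure V" using D[OF j] closure_subset by blast
    then have "compact (closure (D j))" by (rule compact_closure_if_subset_compact[OF V(4)])
    moreover have "interior (D j) \<noteq> {}" using D[OF j] by (simp add: interior_open)
    ultimately show "equidecomposable G a UNIV X (D j)"
      using paradoxical X unfolding paradoxical_action_def by blast
  qed
  then obtain h W where hW: "\<And>j. j < 2 * n \<Longrightarrow> K j (h j) (W j)" by metis
  have h_inj: "inj_on (h j) X" and h_img: "h j ` X = D j"
    and h_W: "\<And>x. x \<in> X \<Longrightarrow> \<exists>w\<in>W j. h j x = a w x"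
    and W: "finite (W j)" "W j \<subseteq> carrier G" if "j < 2 * n" for j
    using hW[OF that] unfolding K_def bij_betw_def by auto
  have "\<forall>v\<in>V. \<exists>y. y \<in> B \<and> (\<exists>t\<in>T. v = a t y)"
  proof
    fix v assume "v \<in> V"
    then have "v \<in> (\<Union>t\<in>T. a t ` B)" using UT V(3) unfolding translates_def by blast
    then show "\<exists>y. y \<in> B \<and> (\<exists>t\<in>T. v = a t y)" by blast
  qed
  then obtain b where b: "\<forall>v\<in>V. b v \<in> B \<and> (\<exists>t\<in>T. v = a t (b v))"
    by (rule bchoice[THEN exE])
  define W' where "W' = (\<lambda>(t, w). inv\<^bsub>G\<^esub> t \<otimes>\<^bsub>G\<^esub> w) ` (T \<times> (\<Union>j<2 * n. W j))"
  have "finite W'" unfolding W'_def using T W(1) by (intro finite_imageI finite_cartesian_product) auto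
  moreover have "W' \<subseteq> carrier G"
  proof
    fix u assume "u \<in> W'"
    then obtain t w j where "t \<in> T" "j < 2 * n" "w \<in> W j" "u = inv\<^bsub>G\<^esub> t \<otimes>\<^bsub>G\<^esub> w"
      by (auto simp: W'_def)
    then show "u \<in> carrier G"
      using T W(2)[of j] group.inv_closed[OF paradoxical_group]
        monoid.m_closed[OF group.is_monoid[OF paradoxical_group]] by blast
  qed
  moreover have "2 * card F \<le> card (moves (a ` W') F \<inter> B)" if F: "finite F" "F \<subseteq> A" for F
  proof -
    have FX: "F \<subseteq> X" using F(2) by (auto simp: X_def)
    have hF: "h j ` F \<subseteq> D j" if "j < 2 * n" for j
      using image_mono[OF FX, of "h j"] unfolding h_img[OF that] .
    define Q where "Q = (\<Union>j<2 * n. h j ` F)"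
    have finQ: "finite Q" using F(1) by (simp add: Q_def)
    have QV: "Q \<subseteq> V"
    proof
      fix v assume "v \<in> Q"
      then obtain j where j: "j < 2 * n" "v \<in> h j ` F" by (auto simp: Q_def)
      then have "v \<in> D j" using hF[OF j(1)] by blast
      then show "v \<in> V" using D[OF j(1)] by blast
    qed
    have "card Q = (\<Sum>j<2 * n. card (h j ` F))"
      unfolding Q_def
    proof (rule card_UN_disjoint)
      show "\<forall>i\<in>{..<2 * n}. \<forall>j\<in>{..<2 * n}. i \<noteq> j \<longrightarrow> h i ` F \<inter> h j ` F = {}"
      proof (intro ballI impI)
        fix i j assume ij: "i \<in> {..<2 * n}" "j \<in> {..<2 * n}" "i \<noteq> j"
        have "h i ` F \<subseteq> D i" "h j ` F \<subseteq> D j" using hF ij by auto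
        moreover have "D i \<inter> D j = {}" using disD ij unfolding disjoint_family_on_def by blast
        ultimately show "h i ` F \<inter> h j ` F = {}" by blast
      qed
    qed (use F(1) in auto)
    also have "\<dots> = (\<Sum>j<2 * n. card F)"
      using h_inj FX by (intro sum.cong refl card_image) (auto intro: inj_on_subset)
    finally have cardQ: "card Q = 2 * n * card F" by simp
    have "Q \<subseteq> (\<Union>y\<in>b ` Q. (\<lambda>t. a t y) ` T)"
    proof
      fix v assume v: "v \<in> Q"
      then obtain t where "t \<in> T" "v = a t (b v)" using b QV by blast
      then show "v \<in> (\<Union>y\<in>b ` Q. (\<lambda>t. a t y) ` T)" using v by blast
    qed
    then have "card Q \<le> card (\<Union>y\<in>b ` Q. (\<lambda>t. a t y) ` T)"
      using finQ T(1) by (intro card_mono) auto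
    also have "\<dots> \<le> (\<Sum>y\<in>b ` Q. card ((\<lambda>t. a t y) ` T))"
      using finQ by (intro card_UN_le) simp
    also have "\<dots> \<le> (\<Sum>y\<in>b ` Q. n)" unfolding n_def by (intro sum_mono card_image_le T(1))
    finally have "2 * n * card F \<le> card (b ` Q) * n" unfolding cardQ by simp
    then have "n * (2 * card F) \<le> n * card (b ` Q)" by (simp add: algebra_simps)
    then have le: "2 * card F \<le> card (b ` Q)" using n by simp
    have "b ` Q \<subseteq> moves (a ` W') F \<inter> B"
    proof
      fix y assume "y \<in> b ` Q"
      then obtain v where v: "v \<in> Q" "y = b v" by blast
      then obtain j x where j: "j < 2 * n" "x \<in> F" "v = h j x" by (auto simp: Q_def)
      have xX: "x \<in> X" using j(2) FX by blast
      obtain w where w: "w \<in> W j" "h j x = a w x" using h_W[OF j(1) xX] by blast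
      obtain t where t: "t \<in> T" "v = a t y" and yB: "y \<in> B" using b QV v by blast
      have tG: "t \<in> carrier G" and wG: "w \<in> carrier G" using t(1) T(2) w(1) W(2)[OF j(1)] by auto
      have "y = a (inv\<^bsub>G\<^esub> t) (a w x)" using action_inv[OF tG, of y] t(2) j(3) w(2) by simp
      then have "y = a (inv\<^bsub>G\<^esub> t \<otimes>\<^bsub>G\<^esub> w) x"
        using action_mult[OF group.inv_closed[OF paradoxical_group tG] wG] by simp
      moreover have "inv\<^bsub>G\<^esub> t \<otimes>\<^bsub>G\<^esub> w \<in> W'" using t(1) w(1) j(1)
        unfolding W'_def by (intro image_eqI[of _ _ "(t, w)"]) auto
      ultimately have "y \<in> moves (a ` W') F" using j(2) unfolding moves_def by blast
      then show "y \<in> moves (a ` W') F \<inter> B" using yB by blast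
    qed
    then have "card (b ` Q) \<le> card (moves (a ` W') F \<inter> B)"
      using \<open>finite W'\<close> F(1) by (intro card_mono) (auto intro: finite_moves)
    with le show ?thesis by (rule order_trans)
  qed
  ultimately show ?thesis by blast
qed

lemma covering_family_if_equidecomposable:
  assumes eq: "equidecomposable G a \<F> B A" and A: "A \<in> covering_family G a"
  shows "B \<in> covering_family G a"
proof -
  obtain h W where W: "finite W" "W \<subseteq> carrier G" and h: "bij_betw h B A"
    and hW: "\<And>x. x \<in> B \<Longrightarrow> \<exists>w\<in>W. h x = a w x"
    using action_equidecomposable_bijection[OF eq] by auto
  obtain U T where cA: "compact (closure A)" and U: "open U" "U \<noteq> {}"
    and T: "finite T" "T \<subseteq> carrier G" and UT: "U \<subseteq> translates a T A"
    using A by (rule covering_familyE)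
  have inv: "inv\<^bsub>G\<^esub> w \<in> carrier G" if "w \<in> W" for w
    using group.inv_closed[OF paradoxical_group] W(2) that by blast
  let ?C = "\<Union>w\<in>W. closure (a (inv\<^bsub>G\<^esub> w) ` closure A)"
  have "compact (closure (a (inv\<^bsub>G\<^esub> w) ` closure A))" if "w \<in> W" for w
    using paradoxical cA inv[OF that] unfolding paradoxical_action_def by blast
  then have "compact ?C" using W(1) by (intro compact_UN) auto
  moreover have "B \<subseteq> ?C"
  proof
    fix x assume x: "x \<in> B"
    obtain w where w: "w \<in> W" "h x = a w x" using hW[OF x] by blast
    have "h x \<in> A" using h x by (rule bij_betw_apply)
    then have "a w x \<in> closure A" using w(2) closure_subset by auto
    then have "a (inv\<^bsub>G\<^esub> w) (a w x) \<in> a (inv\<^bsub>G\<^esub> w) ` closure A" by blast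
    moreover have "w \<in> carrier G" using w(1) W(2) by blast
    ultimately have "x \<in> a (inv\<^bsub>G\<^esub> w) ` closure A"
      by (simp only: action_inv)
    then have "x \<in> closure (a (inv\<^bsub>G\<^esub> w) ` closure A)"
      by (rule subsetD[OF closure_subset])
    then show "x \<in> ?C" using w(1) by (rule UN_I[rotated])
  qed
  ultimately have "compact (closure B)" by (rule compact_closure_if_subset_compact)
  moreover have "covers G a B U"
  proof -
    let ?S = "(\<lambda>(t, w). t \<otimes>\<^bsub>G\<^esub> w) ` (T \<times> W)"
    have "finite ?S" using T(1) W(1) by simp
    moreover have "?S \<subseteq> carrier G"
      using T(2) W(2) monoid.m_closed[OF group.is_monoid[OF paradoxical_group]] by auto
    moreover have "U \<subseteq> translates a ?S B"
    proof
      fix u assume "u \<in> U"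
      then obtain t y where t: "t \<in> T" "y \<in> A" "u = a t y" using UT unfolding translates_def by blast
      obtain x where x: "x \<in> B" "y = h x" using h t(2) unfolding bij_betw_def by blast
      obtain w where w: "w \<in> W" "h x = a w x" using hW[OF x(1)] by blast
      have "t \<in> carrier G" "w \<in> carrier G" using t(1) T(2) w(1) W(2) by auto
      then have "u = a (t \<otimes>\<^bsub>G\<^esub> w) x"
        using t(3) x(2) w(2) by (simp add: action_mult)
      moreover have "t \<otimes>\<^bsub>G\<^esub> w \<in> ?S" using t(1) w(1) by auto
      ultimately show "u \<in> translates a ?S B" using x(1) unfolding translates_def by blast
    qed
    ultimately show ?thesis unfolding covers_def by (intro exI[of _ ?S] conjI)
  qed
  ultimately show ?thesis unfolding covering_family_def using U by blast
qed

lemma equidecomposable_refl: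
  assumes "A \<in> sets M"
  shows "equidecomposable G a (sets M) A A"
proof (rule equidecomposable_if_piecewise_bijection)
  have one: "a \<one>\<^bsub>G\<^esub> = id" by (rule action_one)
  show "finite {\<one>\<^bsub>G\<^esub>}" by simp
  show "{\<one>\<^bsub>G\<^esub>} \<subseteq> carrier G"
    using monoid.one_closed[OF group.is_monoid[OF paradoxical_group]] by simp
  show "piecewise_injection (a ` {\<one>\<^bsub>G\<^esub>}) M A A id"
    using assms by (simp add: piecewise_injection_def one)
qed simp

lemma symmetric_maps_action:
  assumes "finite W" "W \<subseteq> carrier G"
  shows "\<exists>W'. W \<subseteq> W' \<and> finite W' \<and> W' \<subseteq> carrier G \<and> symmetric_maps (a ` W')"
proof (intro exI conjI)
  note grp = paradoxical_group
  let ?W = "insert \<one>\<^bsub>G\<^esub> (W \<union> (\<lambda>w. inv\<^bsub>G\<^esub> w) ` W)"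
  show "W \<subseteq> ?W" by blast
  show fin: "finite ?W" using assms(1) by simp
  show car: "?W \<subseteq> carrier G"
    using assms(2) group.inv_closed[OF grp] monoid.one_closed[OF group.is_monoid[OF grp]] by auto
  show "symmetric_maps (a ` ?W)"
  proof
    show "finite (a ` ?W)" using fin by (rule finite_imageI)
    show "id \<in> a ` ?W" using action_one by (metis imageI insertI1)
    fix e assume "e \<in> a ` ?W"
    then obtain w where w: "w \<in> ?W" "e = a w" by blast
    have wG: "w \<in> carrier G" using w(1) car by blast
    have "inv\<^bsub>G\<^esub> w \<in> ?W"
    proof -
      consider "w = \<one>\<^bsub>G\<^esub>" | "w \<in> W" | v where "v \<in> W" "w = inv\<^bsub>G\<^esub> v" using w(1) by blast
      then show ?thesis
      proof cases
        case 1
        then show ?thesis using monoid.inv_one[OF group.is_monoid[OF grp]] by simp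
      next
        case (3 v)
        then have "inv\<^bsub>G\<^esub> w = v" using group.inv_inv[OF grp] assms(2) by auto
        then show ?thesis using 3(1) by simp
      qed simp
    qed
    moreover have "a (inv\<^bsub>G\<^esub> w) \<circ> e = id" "e \<circ> a (inv\<^bsub>G\<^esub> w) = id"
      using action_inv[OF wG] action_inv'[OF wG] w(2)
      by (simp_all add: fun_eq_iff)
    ultimately show "\<exists>e'\<in>a ` ?W. e' \<circ> e = id \<and> e \<circ> e' = id" by blast
  qed
qed

text \<open>
  Both parts of the theorem are instances of this: the \<open>\<sigma>\<close>-algebra is the power set in one case and
  consists of the sets with the property of Baire in the other, and they differ in how expansion
  produces a matching.
\<close>

lemma equidecomposable_if_matching:
  assumes A: "A \<in> covering_family G a" "A \<in> sets M" and B: "B \<in> covering_family G a" "B \<in> sets M"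
    and img: "\<And>\<gamma> Y. \<gamma> \<in> carrier G \<Longrightarrow> Y \<in> sets M \<Longrightarrow> a \<gamma> ` Y \<in> sets M"
    and matching: "\<And>W X Y. symmetric_maps (a ` W) \<Longrightarrow> W \<subseteq> carrier G \<Longrightarrow> X \<in> sets M \<Longrightarrow> Y \<in> sets M \<Longrightarrow>
      (\<And>F. finite F \<Longrightarrow> F \<subseteq> X \<Longrightarrow> 2 * card F \<le> card (moves (a ` W) F \<inter> Y)) \<Longrightarrow>
      \<exists>f. piecewise_injection (a ` W) M X Y f"
  shows "equidecomposable G a (sets M) A B"
proof (cases "\<exists>x y :: 'x. x \<noteq> y")
  case False
  \<comment> \<open>In a one-point space expansion fails, but \<open>A\<close> and \<open>B\<close> are equal.\<close>
  have "A \<noteq> {}" "B \<noteq> {}"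
    using A(1) B(1) by (auto simp: covering_family_def covers_def translates_def)
  moreover have "X = UNIV" if "X \<noteq> {}" for X :: "'x set"
  proof -
    obtain p where "p \<in> X" using \<open>X \<noteq> {}\<close> by blast
    then show ?thesis using False by (metis UNIV_eq_I)
  qed
  ultimately have "A = B" by metis
  then show ?thesis using equidecomposable_refl[OF A(2)] by simp
next
  case True
  then obtain x0 y0 :: 'x where two: "x0 \<noteq> y0" by blast
  obtain W1 where W1: "finite W1" "W1 \<subseteq> carrier G"
    "\<forall>F. finite F \<and> F \<subseteq> A \<longrightarrow> 2 * card F \<le> card (moves (a ` W1) F \<inter> B)"
    using covering_family_expansion[OF two A(1) B(1)] by (elim exE conjE)
  obtain W2 where W2: "finite W2" "W2 \<subseteq> carrier G"
    "\<forall>F. finite F \<and> F \<subseteq> B \<longrightarrow> 2 * card F \<le> card (moves (a ` W2) F \<inter> A)"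
    using covering_family_expansion[OF two B(1) A(1)] by (elim exE conjE)
  have "finite (W1 \<union> W2)" "W1 \<union> W2 \<subseteq> carrier G" using W1 W2 by auto
  from symmetric_maps_action[OF this]
  obtain W where W: "W1 \<union> W2 \<subseteq> W" "finite W" "W \<subseteq> carrier G" and sym: "symmetric_maps (a ` W)"
    by (elim exE conjE)
  have mono: "card (moves (a ` V) F \<inter> Z) \<le> card (moves (a ` W) F \<inter> Z)"
    if "V \<subseteq> W" "finite F" for V F Z
  proof (rule card_mono)
    show "finite (moves (a ` W) F \<inter> Z)" 
      using finite_moves[OF finite_imageI[OF W(2), of a] that(2)] by simp
    show "moves (a ` V) F \<inter> Z \<subseteq> moves (a ` W) F \<inter> Z" using that(1) unfolding moves_def by blast
  qed
  have "\<exists>f. piecewise_injection (a ` W) M A B f"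
  proof (rule matching[OF sym W(3) A(2) B(2)])
    fix F assume F: "finite F" "F \<subseteq> A"
    have "2 * card F \<le> card (moves (a ` W1) F \<inter> B)" using W1(3) F by blast
    also have "\<dots> \<le> card (moves (a ` W) F \<inter> B)" using W(1) F(1) by (intro mono) auto
    finally show "2 * card F \<le> card (moves (a ` W) F \<inter> B)" .
  qed
  then obtain f where f: "piecewise_injection (a ` W) M A B f" ..
  have "\<exists>g. piecewise_injection (a ` W) M B A g"
  proof (rule matching[OF sym W(3) B(2) A(2)])
    fix F assume F: "finite F" "F \<subseteq> B"
    have "2 * card F \<le> card (moves (a ` W2) F \<inter> A)" using W2(3) F by blast
    also have "\<dots> \<le> card (moves (a ` W) F \<inter> A)" using W(1) F(1) by (intro mono) auto
    finally show "2 * card F \<le> card (moves (a ` W) F \<inter> A)" .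
  qed
  then obtain g where g: "piecewise_injection (a ` W) M B A g" ..
  have "\<exists>h. piecewise_injection (a ` W) M A B h \<and> h ` A = B"
  proof (rule symmetric_maps.piecewise_Schroeder_Bernstein[OF sym _ A(2) B(2) f g])
    fix e Y assume "e \<in> a ` W" "Y \<in> sets M"
    then show "e ` Y \<in> sets M" using img W(3) by auto
  qed
  then obtain h where "piecewise_injection (a ` W) M A B h" "h ` A = B" by blast
  then show ?thesis by (rule equidecomposable_if_piecewise_bijection[OF W(2,3)])
qed

lemma equidecomposable_covering_family:
  assumes "A \<in> covering_family G a" "B \<in> covering_family G a"
  shows "equidecomposable G a UNIV A B"
proof -
  have "equidecomposable G a (sets (count_space UNIV)) A B"
  proof (rule equidecomposable_if_matching)
    fix W and X Y :: "'x set"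
    assume sym: "symmetric_maps (a ` W)"
      and exp: "\<And>F. finite F \<Longrightarrow> F \<subseteq> X \<Longrightarrow> 2 * card F \<le> card (moves (a ` W) F \<inter> Y)"
    have "hall (a ` W) X Y" by (rule hall_if_expanding[OF exp])
    then show "\<exists>f. piecewise_injection (a ` W) (count_space UNIV) X Y f"
      unfolding hall_iff_injection[OF symmetric_maps.finite_E[OF sym]]
      by (simp add: piecewise_injection_def)
  qed (simp_all add: assms)
  then show ?thesis by simp
qed

lemma equidecomposable_baire_property:
  assumes A: "A \<in> covering_family G a" "A \<in> baire_property_sets"
    and B: "B \<in> covering_family G a" "B \<in> baire_property_sets"
    and meager: "invariant_family G a {S. meager S}"
  shows "equidecomposable G a baire_property_sets A B"
proof -
  have borel: "a \<gamma> \<in> borel \<rightarrow>\<^sub>M borel" if "\<gamma> \<in> carrier G" for \<gamma>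
  proof -
    have "\<forall>\<gamma>\<in>carrier G. borel_automorphism (a \<gamma>)"
      using paradoxical by (simp add: paradoxical_action_def borel_action_def)
    then show ?thesis using that by (simp add: borel_automorphism_def)
  qed
  note inv_closed = group.inv_closed[OF paradoxical_group]
  have vimage_meager: "meager (a \<gamma> -` S)" if "\<gamma> \<in> carrier G" "meager S" for \<gamma> S
    unfolding action_vimage[OF that(1)]
    using meager inv_closed[OF that(1)] that(2) unfolding invariant_family_def by simp
  have "equidecomposable G a (sets baire_algebra) A B"
  proof (rule equidecomposable_if_matching)
    fix \<gamma> and Y :: "'x set" assume \<gamma>: "\<gamma> \<in> carrier G" and Y: "Y \<in> sets baire_algebra"
    note \<gamma>' = inv_closed[OF \<gamma>]
    have "a (inv\<^bsub>G\<^esub> \<gamma>) \<in> baire_algebra \<rightarrow>\<^sub>M baire_algebra"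
      by (rule measurable_baire_algebra[OF action_bij[OF \<gamma>'] borel[OF \<gamma>'] vimage_meager[OF \<gamma>']])
    from measurable_sets[OF this Y] have "a (inv\<^bsub>G\<^esub> \<gamma>) -` Y \<in> sets baire_algebra" by simp
    then show "a \<gamma> ` Y \<in> sets baire_algebra"
      unfolding action_vimage[OF \<gamma>'] group.inv_inv[OF paradoxical_group \<gamma>] .
  next
    fix W and X Y :: "'x set"
    assume sym: "symmetric_maps (a ` W)" and W: "W \<subseteq> carrier G"
      and X: "X \<in> sets baire_algebra" and Y: "Y \<in> sets baire_algebra"
      and exp: "\<And>F. finite F \<Longrightarrow> F \<subseteq> X \<Longrightarrow> 2 * card F \<le> card (moves (a ` W) F \<inter> Y)"
    have "generic_maps (a ` W)"
      unfolding generic_maps_def generic_maps_axioms_def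
    proof (intro conjI allI impI sym)
      fix e assume "e \<in> a ` W"
      then show "e \<in> borel \<rightarrow>\<^sub>M borel" using borel W by blast
    next
      fix e and S :: "'x set" assume "e \<in> a ` W" "meager S"
      then show "meager (e -` S)" using vimage_meager W by blast
    qed
    then show "\<exists>f. piecewise_injection (a ` W) baire_algebra X Y f"
      using X Y exp by (rule generic_maps.baire_matching)
  qed (simp_all add: A B sets_baire_algebra)
  then show ?thesis unfolding sets_baire_algebra .
qed

end

lemma baire_property_if_equidecomposable:
  assumes "equidecomposable G a baire_property_sets B A"
  shows "B \<in> baire_property_sets"
proof -
  obtain m :: nat and P where P: "\<And>i. i < m \<Longrightarrow> P i \<in> baire_property_sets" "(\<Union>i<m. P i) = B"
    using assms unfolding equidecomposable_def by auto
  have "(\<Union>i<m. P i) \<in> sets baire_algebra"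
    using P(1) by (intro sets.finite_UN) (simp_all add: sets_baire_algebra)
  then show ?thesis unfolding P(2) sets_baire_algebra .
qed

theorem proposition1p8:
  fixes G :: "('g, 'm) monoid_scheme"
    and a :: "'g \<Rightarrow> 'x::polish_space \<Rightarrow> 'x"
    and A :: "'x set"
  assumes "paradoxical_action G a"
    and "A \<in> covering_family G a"
  shows "(\<forall>B. equidecomposable G a UNIV B A \<longleftrightarrow> B \<in> covering_family G a) \<and>
    (A \<in> baire_property_sets \<and> invariant_family G a {S. meager S} \<longrightarrow>
      (\<forall>B. equidecomposable G a baire_property_sets B A \<longleftrightarrow>
            B \<in> covering_family G a \<inter> baire_property_sets))"
proof (intro conjI allI impI iffI)
  fix B assume "equidecomposable G a UNIV B A"
  then show "B \<in> covering_family G a"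
    by (rule covering_family_if_equidecomposable[OF assms(1) _ assms(2)])
next
  fix B assume "B \<in> covering_family G a"
  then show "equidecomposable G a UNIV B A"
    by (rule equidecomposable_covering_family[OF assms(1) _ assms(2)])
next
  fix B assume "equidecomposable G a baire_property_sets B A"
  then show "B \<in> covering_family G a \<inter> baire_property_sets"
    using covering_family_if_equidecomposable[OF assms(1) _ assms(2)]
      baire_property_if_equidecomposable by blast
next
  fix B
  assume "A \<in> baire_property_sets \<and> invariant_family G a {S. meager S}"
    and "B \<in> covering_family G a \<inter> baire_property_sets"
  then show "equidecomposable G a baire_property_sets B A"
    using equidecomposable_baire_property[OF assms(1) _ _ assms(2)] by simp
qed

end
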